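(* Let $\mathfrak m$ be a $\mathbb K$-module with a strongly non-degenerate symmetric or skew-symmetric bilinear form $\beta$, let $k\geq 2$ be such that $2,\ldots,k-1$ are invertible in $\mathbb K$, let $(\mathcal F_k,\mathcal F_k)$ be the linear pair geometry of complemented flags of length $k$ in $\mathfrak m$, and let $\mathcal L_k\subset\mathcal F_k$ be the set of complemented Lagrangian flags of length $k$. Then the map $$(\mathcal F_k,\mathcal F_k)\to(\mathcal F_k,\mathcal F_k),\qquad(\mathfrak e,\mathfrak f)\mapsto(\mathfrak e^\perp,\mathfrak f^\perp)$$ is an automorphism of the flag geometry $(\mathcal F_k,\mathcal F_k)$ whose fixed point set is $(\mathcal L_k,\mathcal L_k)$. In particular, the Lagrangian geometry $(\mathcal L_k,\mathcal L_k)$ is a subspace of the linear pair geometry $(\mathcal F_k,\mathcal F_k)$. The linear pair geometry $(\mathcal L_k,\mathcal L_k)$ is an affine pair geometry if $k=2$.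
   Context: $\mathbb K$ is a commutative ring with unit $1$ in which $2$ is invertible; "linear subspace" means $\mathbb K$-submodule. Strongly non-degenerate means that $\mathfrak m\to\mathfrak m^*$, $v\mapsto\beta(v,\cdot)$ is bijective. Flags: a flag of length $k$ in $\mathfrak m$ is $\mathfrak f=(\mathfrak f_1,\ldots,\mathfrak f_k)$, $0\subset\mathfrak f_1\subset\cdots\subset\mathfrak f_k=\mathfrak m$ with strict inclusions of linear subspaces; $\mathfrak f_0=0$. $\mathfrak f\top\mathfrak f'$ (transversal) means $\mathfrak f_i\oplus\mathfrak f'_{k-i}=\mathfrak m$ for $i=1,\ldots,k$. A flag is complemented if it has a transversal flag; $\mathcal F_k$ is the set of these. For a flag $\mathfrak f$, $\mathfrak f^\perp$ is the flag with $(\mathfrak f^\perp)_j=(\mathfrak f_{k-j})^\perp$, orthogonal complements with respect to $\beta$. A flag is Lagrangian if $\mathfrak f_j^\perp=\mathfrak f_{k-j}$ for all $j=1,\ldots,k$; a Lagrangian flag is complemented (as a Lagrangian flag) if there is a Lagrangian flag transversal to it; $\mathcal L_k$ is the set of complemented Lagrangian flags. A linear pair geometry over $\mathbb K$ is a pair of sets $(\mathcal X,\mathcal X')$ with a relation $\top\subset\mathcal X\times\mathcal X'$ such that every element of either set is transversal to some element of the other, and such that for every $x\top\alpha$ the sets $\mathfrak v_\alpha=\{y\in\mathcal X:y\top\alpha\}$ and $\mathfrak v'_x=\{\gamma\in\mathcal X':x\top\gamma\}$ carry $\mathbb K$-module structures $(\mathfrak v_\alpha,x)$, $(\mathfrak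 v'_x,\alpha)$ with zero vectors $x$, $\alpha$. It is an affine pair geometry if the affine structure underlying $(\mathfrak v_\alpha,x)$ does not depend on $x\in\mathfrak v_\alpha$, for all $\alpha$, and dually. A homomorphism is a pair of maps $(g,g')$ preserving transversality and inducing linear maps $(\mathfrak v_\alpha,x)\to(\mathfrak v_{g'\alpha},gx)$ and dually, for all $x\top\alpha$; an automorphism is an invertible homomorphism from the geometry to itself. A pair $(\mathcal Y,\mathcal Y')$ of subsets $\mathcal Y\subset\mathcal X$, $\mathcal Y'\subset\mathcal X'$ is a subspace if every $x\in\mathcal Y$ is transversal to some $a\in\mathcal Y'$ and vice versa, and if for every transversal pair $(x,a)\in\mathcal Y\times\mathcal Y'$ the set $\mathcal Y\cap\mathfrak v_a$ is a linear subspace of $(\mathfrak v_a,x)$ and $\mathcal Y'\cap\mathfrak v'_x$ is a linear subspace of $(\mathfrak v'_x,a)$; then $(\mathcal Y,\mathcal Y')$ is itself a linear pair geometry. Linear structure on $(\mathcal F_k,\mathcal F_k)$: let $\mathfrak u(\mathfrak f)=\{X\in\mathrm{End}(\mathfrak m):X(\mathfrak f_i)\subset\mathfrak f_{i-1}\ \forall i\}$, $\exp(X)=\sum_{i=0}^{k-1}X^i/i!$, and let $\mathrm{GL}(\mathfrak m)$ act on flags by $(g.\mathfrak e)_i=g(\mathfrak e_i)$. For $\mathfrak e\top\mathfrak f$, the map $\mathfrak u(\mathfrak f)\to\mathfrak f^\top$, $X\mapsto\exp(X).\mathfrak e$ is a bijection, and it is declared to be a linear isomorphism onto $(\mathfrak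 f^\top,\mathfrak e)$. *)

theory Defs
  imports Complex_Main
begin

text \<open>The sets $v_\alpha$ of a pair geometry overlap and carry many different module
  structures, so the type-based locale \<^locale>\<open>module\<close> does not apply to them.\<close>

definition module_on ::
  "'v set \<Rightarrow> 'v \<Rightarrow> ('v \<Rightarrow> 'v \<Rightarrow> 'v) \<Rightarrow> ('k::comm_ring_1 \<Rightarrow> 'v \<Rightarrow> 'v) \<Rightarrow> bool" where
  "module_on V z add smul \<longleftrightarrow>
     z \<in> V \<and>
     (\<forall>a\<in>V. \<forall>b\<in>V. add a b \<in> V) \<and>
     (\<forall>r. \<forall>a\<in>V. smul r a \<in> V) \<and>
     (\<forall>a\<in>V. \<forall>b\<in>V. \<forall>c\<in>V. add (add a b) c = add a (add b c)) \<and>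
     (\<forall>a\<in>V. \<forall>b\<in>V. add a b = add b a) \<and>
     (\<forall>a\<in>V. add z a = a) \<and>
     (\<forall>a\<in>V. \<exists>b\<in>V. add a b = z) \<and>
     (\<forall>r. \<forall>a\<in>V. \<forall>b\<in>V. smul r (add a b) = add (smul r a) (smul r b)) \<and>
     (\<forall>r s. \<forall>a\<in>V. smul (r + s) a = add (smul r a) (smul s a)) \<and>
     (\<forall>r s. \<forall>a\<in>V. smul r (smul s a) = smul (r * s) a) \<and>
     (\<forall>a\<in>V. smul 1 a = a)"

definition linear_subspace_on ::
  "'v set \<Rightarrow> 'v set \<Rightarrow> 'v \<Rightarrow> ('v \<Rightarrow> 'v \<Rightarrow> 'v) \<Rightarrow> ('k::comm_ring_1 \<Rightarrow> 'v \<Rightarrow> 'v) \<Rightarrow> bool" where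
  "linear_subspace_on W V z add smul \<longleftrightarrow>
     W \<subseteq> V \<and> z \<in> W \<and>
     (\<forall>a\<in>W. \<forall>b\<in>W. add a b \<in> W) \<and>
     (\<forall>r. \<forall>a\<in>W. smul r a \<in> W)"

definition linear_map_on ::
  "'v set \<Rightarrow> ('v \<Rightarrow> 'v \<Rightarrow> 'v) \<Rightarrow> ('k::comm_ring_1 \<Rightarrow> 'v \<Rightarrow> 'v) \<Rightarrow>
   'w set \<Rightarrow> ('w \<Rightarrow> 'w \<Rightarrow> 'w) \<Rightarrow> ('k \<Rightarrow> 'w \<Rightarrow> 'w) \<Rightarrow> ('v \<Rightarrow> 'w) \<Rightarrow> bool" where
  "linear_map_on V addV smulV W addW smulW g \<longleftrightarrow>
     g ` V \<subseteq> W \<and>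
     (\<forall>a\<in>V. \<forall>b\<in>V. g (addV a b) = addW (g a) (g b)) \<and>
     (\<forall>r. \<forall>a\<in>V. g (smulV r a) = smulW r (g a))"

text \<open>The ternary operations $(a,b,c) \mapsto a + r(b - c)$ determine, and are determined by, all
  affine combinations: $r = 1$ gives the torsor structure, $c = a$ gives $(1-r)a + rb$, and
  every affine combination is an iterate of these.\<close>

definition affine_op ::
  "('v \<Rightarrow> 'v \<Rightarrow> 'v) \<Rightarrow> ('k::comm_ring_1 \<Rightarrow> 'v \<Rightarrow> 'v) \<Rightarrow> 'k \<Rightarrow> 'v \<Rightarrow> 'v \<Rightarrow> 'v \<Rightarrow> 'v" where
  "affine_op add smul r a b c = add a (smul r (add b (smul (- 1) c)))"

definition same_affine_structure ::
  "'v set \<Rightarrow> ('v \<Rightarrow> 'v \<Rightarrow> 'v) \<Rightarrow> ('k::comm_ring_1 \<Rightarrow> 'v \<Rightarrow> 'v) \<Rightarrow>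
   ('v \<Rightarrow> 'v \<Rightarrow> 'v) \<Rightarrow> ('k \<Rightarrow> 'v \<Rightarrow> 'v) \<Rightarrow> bool" where
  "same_affine_structure V add1 smul1 add2 smul2 \<longleftrightarrow>
     (\<forall>r. \<forall>a\<in>V. \<forall>b\<in>V. \<forall>c\<in>V. affine_op add1 smul1 r a b c = affine_op add2 smul2 r a b c)"

text \<open>For $x \top \alpha$, the fields \<open>add_pt x \<alpha>\<close>, \<open>smul_pt x \<alpha>\<close> are the operations of the
  module $(v_\alpha, x)$, and \<open>add_co x \<alpha>\<close>, \<open>smul_co x \<alpha>\<close> those of $(v'_x, \alpha)$.\<close>

record ('k, 'x, 'y) pair_geometry =
  points :: "'x set"
  copoints :: "'y set"
  transv :: "'x \<Rightarrow> 'y \<Rightarrow> bool"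
  add_pt :: "'x \<Rightarrow> 'y \<Rightarrow> 'x \<Rightarrow> 'x \<Rightarrow> 'x"
  smul_pt :: "'x \<Rightarrow> 'y \<Rightarrow> 'k \<Rightarrow> 'x \<Rightarrow> 'x"
  add_co :: "'x \<Rightarrow> 'y \<Rightarrow> 'y \<Rightarrow> 'y \<Rightarrow> 'y"
  smul_co :: "'x \<Rightarrow> 'y \<Rightarrow> 'k \<Rightarrow> 'y \<Rightarrow> 'y"

definition v_pt :: "('k, 'x, 'y) pair_geometry \<Rightarrow> 'y \<Rightarrow> 'x set" where
  "v_pt G \<alpha> = {y \<in> points G. transv G y \<alpha>}"

definition v_co :: "('k, 'x, 'y) pair_geometry \<Rightarrow> 'x \<Rightarrow> 'y set" where
  "v_co G x = {\<gamma> \<in> copoints G. transv G x \<gamma>}"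

definition linear_pair_geometry :: "('k::comm_ring_1, 'x, 'y) pair_geometry \<Rightarrow> bool" where
  "linear_pair_geometry G \<longleftrightarrow>
     (\<forall>x \<alpha>. transv G x \<alpha> \<longrightarrow> x \<in> points G \<and> \<alpha> \<in> copoints G) \<and>
     (\<forall>x\<in>points G. \<exists>\<alpha>\<in>copoints G. transv G x \<alpha>) \<and>
     (\<forall>\<alpha>\<in>copoints G. \<exists>x\<in>points G. transv G x \<alpha>) \<and>
     (\<forall>x \<alpha>. transv G x \<alpha> \<longrightarrow>
        module_on (v_pt G \<alpha>) x (add_pt G x \<alpha>) (smul_pt G x \<alpha>) \<and>
        module_on (v_co G x) \<alpha> (add_co G x \<alpha>) (smul_co G x \<alpha>))"

definition affine_pair_geometry :: "('k::comm_ring_1, 'x, 'y) pair_geometry \<Rightarrow> bool" where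
  "affine_pair_geometry G \<longleftrightarrow>
     linear_pair_geometry G \<and>
     (\<forall>\<alpha>\<in>copoints G. \<forall>x\<in>v_pt G \<alpha>. \<forall>y\<in>v_pt G \<alpha>.
        same_affine_structure (v_pt G \<alpha>)
          (add_pt G x \<alpha>) (smul_pt G x \<alpha>) (add_pt G y \<alpha>) (smul_pt G y \<alpha>)) \<and>
     (\<forall>x\<in>points G. \<forall>\<alpha>\<in>v_co G x. \<forall>\<gamma>\<in>v_co G x.
        same_affine_structure (v_co G x)
          (add_co G x \<alpha>) (smul_co G x \<alpha>) (add_co G x \<gamma>) (smul_co G x \<gamma>))"

definition geometry_hom ::
  "('k::comm_ring_1, 'x, 'y) pair_geometry \<Rightarrow> ('k, 'u, 'w) pair_geometry \<Rightarrow>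
   ('x \<Rightarrow> 'u) \<Rightarrow> ('y \<Rightarrow> 'w) \<Rightarrow> bool" where
  "geometry_hom G H g g' \<longleftrightarrow>
     linear_pair_geometry G \<and> linear_pair_geometry H \<and>
     g ` points G \<subseteq> points H \<and> g' ` copoints G \<subseteq> copoints H \<and>
     (\<forall>x \<alpha>. transv G x \<alpha> \<longrightarrow> transv H (g x) (g' \<alpha>)) \<and>
     (\<forall>x \<alpha>. transv G x \<alpha> \<longrightarrow>
        linear_map_on
          (v_pt G \<alpha>) (add_pt G x \<alpha>) (smul_pt G x \<alpha>)
          (v_pt H (g' \<alpha>)) (add_pt H (g x) (g' \<alpha>)) (smul_pt H (g x) (g' \<alpha>)) g \<and>
        linear_map_on
          (v_co G x) (add_co G x \<alpha>) (smul_co G x \<alpha>)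
          (v_co H (g x)) (add_co H (g x) (g' \<alpha>)) (smul_co H (g x) (g' \<alpha>)) g')"

definition geometry_automorphism ::
  "('k::comm_ring_1, 'x, 'y) pair_geometry \<Rightarrow> ('x \<Rightarrow> 'x) \<Rightarrow> ('y \<Rightarrow> 'y) \<Rightarrow> bool" where
  "geometry_automorphism G g g' \<longleftrightarrow>
     geometry_hom G G g g' \<and>
     (\<exists>h h'. geometry_hom G G h h' \<and>
        (\<forall>x\<in>points G. h (g x) = x \<and> g (h x) = x) \<and>
        (\<forall>\<alpha>\<in>copoints G. h' (g' \<alpha>) = \<alpha> \<and> g' (h' \<alpha>) = \<alpha>))"

definition fixed_points ::
  "('k, 'x, 'y) pair_geometry \<Rightarrow> ('x \<Rightarrow> 'x) \<Rightarrow> ('y \<Rightarrow> 'y) \<Rightarrow> 'x set \<times> 'y set" where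
  "fixed_points G g g' = ({x \<in> points G. g x = x}, {\<alpha> \<in> copoints G. g' \<alpha> = \<alpha>})"

definition geometry_subspace ::
  "('k::comm_ring_1, 'x, 'y) pair_geometry \<Rightarrow> 'x set \<Rightarrow> 'y set \<Rightarrow> bool" where
  "geometry_subspace G Y Y' \<longleftrightarrow>
     linear_pair_geometry G \<and>
     Y \<subseteq> points G \<and> Y' \<subseteq> copoints G \<and>
     (\<forall>x\<in>Y. \<exists>\<alpha>\<in>Y'. transv G x \<alpha>) \<and>
     (\<forall>\<alpha>\<in>Y'. \<exists>x\<in>Y. transv G x \<alpha>) \<and>
     (\<forall>x\<in>Y. \<forall>\<alpha>\<in>Y'. transv G x \<alpha> \<longrightarrow>
        linear_subspace_on (Y \<inter> v_pt G \<alpha>) (v_pt G \<alpha>) x (add_pt G x \<alpha>) (smul_pt G x \<alpha>) \<and>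
        linear_subspace_on (Y' \<inter> v_co G x) (v_co G x) \<alpha> (add_co G x \<alpha>) (smul_co G x \<alpha>))"

definition restrict_geometry ::
  "('k, 'x, 'y) pair_geometry \<Rightarrow> 'x set \<Rightarrow> 'y set \<Rightarrow> ('k, 'x, 'y) pair_geometry" where
  "restrict_geometry G Y Y' =
     G\<lparr>points := Y, copoints := Y', transv := (\<lambda>x \<alpha>. x \<in> Y \<and> \<alpha> \<in> Y' \<and> transv G x \<alpha>)\<rparr>"

lemma module_on_linear_subspace:
  assumes V: "module_on V z add (smul :: 'k::comm_ring_1 \<Rightarrow> 'v \<Rightarrow> 'v)"
    and W: "linear_subspace_on W V z add smul"
  shows "module_on W z add smul"
proof -
  have WV: "\<And>a. a \<in> W \<Longrightarrow> a \<in> V"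
    and W_closed: "z \<in> W" "\<And>a b. a \<in> W \<Longrightarrow> b \<in> W \<Longrightarrow> add a b \<in> W"
      "\<And>r a. a \<in> W \<Longrightarrow> smul r a \<in> W"
    using W by (auto simp: linear_subspace_on_def)
  note V' = V[unfolded module_on_def]
  have z: "z \<in> V" using V' by (elim conjE)
  have smul_closed: "\<forall>r. \<forall>a\<in>V. smul r a \<in> V" using V' by (elim conjE)
  have assoc: "\<forall>a\<in>V. \<forall>b\<in>V. \<forall>c\<in>V. add (add a b) c = add a (add b c)" using V' by (elim conjE)
  have comm: "\<forall>a\<in>V. \<forall>b\<in>V. add a b = add b a" using V' by (elim conjE)
  have zero: "\<forall>a\<in>V. add z a = a" using V' by (elim conjE)
  have minus: "\<forall>a\<in>V. \<exists>b\<in>V. add a b = z" using V' by (elim conjE)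
  have distl: "\<forall>r. \<forall>a\<in>V. \<forall>b\<in>V. smul r (add a b) = add (smul r a) (smul r b)"
    using V' by (elim conjE)
  have distr: "\<forall>r s. \<forall>a\<in>V. smul (r + s) a = add (smul r a) (smul s a)" using V' by (elim conjE)
  have smul_smul: "\<forall>r s. \<forall>a\<in>V. smul r (smul s a) = smul (r * s) a" using V' by (elim conjE)
  have one: "\<forall>a\<in>V. smul 1 a = a" using V' by (elim conjE)
  have inv: "\<exists>b\<in>W. add a b = z" if a: "a \<in> W" for a
  proof -
    have aV: "a \<in> V" using WV a .
    have s: "smul 0 a \<in> V" using smul_closed aV by blast
    obtain b where b: "b \<in> V" "add (smul 0 a) b = z" using minus s by blast
    have "add (add (smul 0 a) (smul 0 a)) b = add (smul 0 a) (add (smul 0 a) b)"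
      using assoc s b(1) by blast
    moreover have "add (smul 0 a) (smul 0 a) = smul 0 a"
      using distr[rule_format, OF aV, of 0 0] by simp
    ultimately have "z = add (smul 0 a) z" using b(2) by simp
    also have "\<dots> = add z (smul 0 a)" using comm s z by blast
    also have "\<dots> = smul 0 a" using zero s by blast
    finally have "smul 0 a = z" ..
    then have "add (smul 1 a) (smul (- 1) a) = z"
      using distr[rule_format, OF aV, of 1 "- 1"] by simp
    then have "add a (smul (- 1) a) = z"
      using one[rule_format, OF aV] by simp
    then show ?thesis using W_closed(3)[OF a] by blast
  qed
  show ?thesis
    unfolding module_on_def
    by (intro conjI allI ballI W_closed inv assoc[rule_format] comm[rule_format]
        zero[rule_format] distl[rule_format] distr[rule_format] smul_smul[rule_format]
        one[rule_format] WV)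
qed

lemma linear_pair_geometry_restrict:
  assumes "geometry_subspace G Y Y'"
  shows "linear_pair_geometry (restrict_geometry G Y Y')"
proof -
  have pt: "v_pt (restrict_geometry G Y Y') \<alpha> = Y \<inter> v_pt G \<alpha>" if "\<alpha> \<in> Y'" for \<alpha>
    using assms that by (auto simp: v_pt_def restrict_geometry_def geometry_subspace_def)
  have co: "v_co (restrict_geometry G Y Y') x = Y' \<inter> v_co G x" if "x \<in> Y" for x
    using assms that by (auto simp: v_co_def restrict_geometry_def geometry_subspace_def)
  have sel [simp]: "add_pt (restrict_geometry G Y Y') = add_pt G"
    "smul_pt (restrict_geometry G Y Y') = smul_pt G"
    "add_co (restrict_geometry G Y Y') = add_co G"
    "smul_co (restrict_geometry G Y Y') = smul_co G"
    "points (restrict_geometry G Y Y') = Y" "copoints (restrict_geometry G Y Y') = Y'"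
    "\<And>x \<alpha>. transv (restrict_geometry G Y Y') x \<alpha> \<longleftrightarrow> x \<in> Y \<and> \<alpha> \<in> Y' \<and> transv G x \<alpha>"
    by (simp_all add: restrict_geometry_def)
  have "module_on (Y \<inter> v_pt G \<alpha>) x (add_pt G x \<alpha>) (smul_pt G x \<alpha>) \<and>
        module_on (Y' \<inter> v_co G x) \<alpha> (add_co G x \<alpha>) (smul_co G x \<alpha>)"
    if "x \<in> Y" "\<alpha> \<in> Y'" "transv G x \<alpha>" for x \<alpha>
  proof -
    have "module_on (v_pt G \<alpha>) x (add_pt G x \<alpha>) (smul_pt G x \<alpha>)"
      "module_on (v_co G x) \<alpha> (add_co G x \<alpha>) (smul_co G x \<alpha>)"
      using assms that by (simp_all add: geometry_subspace_def linear_pair_geometry_def)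
    moreover have
      "linear_subspace_on (Y \<inter> v_pt G \<alpha>) (v_pt G \<alpha>) x (add_pt G x \<alpha>) (smul_pt G x \<alpha>)"
      "linear_subspace_on (Y' \<inter> v_co G x) (v_co G x) \<alpha> (add_co G x \<alpha>) (smul_co G x \<alpha>)"
      using assms that by (simp_all add: geometry_subspace_def)
    ultimately show ?thesis by (simp add: module_on_linear_subspace)
  qed
  then have "module_on (v_pt (restrict_geometry G Y Y') \<alpha>) x (add_pt G x \<alpha>) (smul_pt G x \<alpha>) \<and>
        module_on (v_co (restrict_geometry G Y Y') x) \<alpha> (add_co G x \<alpha>) (smul_co G x \<alpha>)"
    if "x \<in> Y" "\<alpha> \<in> Y'" "transv G x \<alpha>" for x \<alpha>
    using that by (simp only: pt co simp_thms)
  moreover have "\<forall>x\<in>Y. \<exists>\<alpha>\<in>Y'. transv G x \<alpha>" "\<forall>\<alpha>\<in>Y'. \<exists>x\<in>Y. transv G x \<alpha>"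
    using assms by (simp_all add: geometry_subspace_def)
  ultimately show ?thesis
    unfolding linear_pair_geometry_def sel by blast
qed

text \<open>A flag $(f_1, \dots, f_k)$ is a function on \<^typ>\<open>nat\<close>, with $f_0 = 0$ and $f_k = m$; it is
  set to $m$ beyond $k$, so that equality of functions is equality of flags.\<close>

definition flag :: "('k::comm_ring_1 \<Rightarrow> 'm::ab_group_add \<Rightarrow> 'm) \<Rightarrow> nat \<Rightarrow> (nat \<Rightarrow> 'm set) \<Rightarrow> bool" where
  "flag scale k f \<longleftrightarrow>
     f 0 = {0} \<and> (\<forall>i\<ge>k. f i = UNIV) \<and>
     (\<forall>i\<le>k. module.subspace scale (f i)) \<and>
     (\<forall>i<k. f i \<subset> f (Suc i))"

definition direct_sum_UNIV :: "'m::ab_group_add set \<Rightarrow> 'm set \<Rightarrow> bool" where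
  "direct_sum_UNIV A B \<longleftrightarrow> A \<inter> B = {0} \<and> (\<forall>v. \<exists>a\<in>A. \<exists>b\<in>B. v = a + b)"

definition flag_transversal ::
  "('k::comm_ring_1 \<Rightarrow> 'm::ab_group_add \<Rightarrow> 'm) \<Rightarrow> nat \<Rightarrow> (nat \<Rightarrow> 'm set) \<Rightarrow> (nat \<Rightarrow> 'm set) \<Rightarrow> bool" where
  "flag_transversal scale k e f \<longleftrightarrow>
     flag scale k e \<and> flag scale k f \<and>
     (\<forall>i\<in>{1..k}. direct_sum_UNIV (e i) (f (k - i)))"

definition complemented_flags ::
  "('k::comm_ring_1 \<Rightarrow> 'm::ab_group_add \<Rightarrow> 'm) \<Rightarrow> nat \<Rightarrow> (nat \<Rightarrow> 'm set) set" where
  "complemented_flags scale k = {e. flag scale k e \<and> (\<exists>f. flag_transversal scale k e f)}"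

definition flag_nilradical ::
  "('k::comm_ring_1 \<Rightarrow> 'm::ab_group_add \<Rightarrow> 'm) \<Rightarrow> nat \<Rightarrow> (nat \<Rightarrow> 'm set) \<Rightarrow> ('m \<Rightarrow> 'm) set" where
  "flag_nilradical scale k f =
     {X. module_hom scale scale X \<and> (\<forall>i\<in>{1..k}. X ` f i \<subseteq> f (i - 1))}"

text \<open>The unique inverse of a unit; \<^class>\<open>comm_ring_1\<close> has no inverse operation.\<close>

definition unit_inverse :: "'k::comm_ring_1 \<Rightarrow> 'k" where
  "unit_inverse a = (THE b. a * b = 1)"

definition nilpotent_exp ::
  "('k::comm_ring_1 \<Rightarrow> 'm::ab_group_add \<Rightarrow> 'm) \<Rightarrow> nat \<Rightarrow> ('m \<Rightarrow> 'm) \<Rightarrow> 'm \<Rightarrow> 'm" where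
  "nilpotent_exp scale k X v = (\<Sum>i<k. scale (unit_inverse (of_nat (fact i))) ((X ^^ i) v))"

definition flag_act :: "('m \<Rightarrow> 'm) \<Rightarrow> (nat \<Rightarrow> 'm set) \<Rightarrow> (nat \<Rightarrow> 'm set)" where
  "flag_act g e = (\<lambda>i. g ` e i)"

text \<open>For $e \top f$ the chart \<open>flag_chart scale k e\<close> is a bijection from
  \<open>flag_nilradical scale k f\<close> onto the set of flags transversal to \<open>f\<close>; \<open>flag_log\<close> is its
  inverse, along which \<open>flag_add\<close> and \<open>flag_smul\<close> transport the pointwise module structure.\<close>

definition flag_chart ::
  "('k::comm_ring_1 \<Rightarrow> 'm::ab_group_add \<Rightarrow> 'm) \<Rightarrow> nat \<Rightarrow> (nat \<Rightarrow> 'm set) \<Rightarrow>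
   ('m \<Rightarrow> 'm) \<Rightarrow> (nat \<Rightarrow> 'm set)" where
  "flag_chart scale k e X = flag_act (nilpotent_exp scale k X) e"

definition flag_log ::
  "('k::comm_ring_1 \<Rightarrow> 'm::ab_group_add \<Rightarrow> 'm) \<Rightarrow> nat \<Rightarrow> (nat \<Rightarrow> 'm set) \<Rightarrow> (nat \<Rightarrow> 'm set) \<Rightarrow>
   (nat \<Rightarrow> 'm set) \<Rightarrow> ('m \<Rightarrow> 'm)" where
  "flag_log scale k e f a = (THE X. X \<in> flag_nilradical scale k f \<and> flag_chart scale k e X = a)"

definition flag_add ::
  "('k::comm_ring_1 \<Rightarrow> 'm::ab_group_add \<Rightarrow> 'm) \<Rightarrow> nat \<Rightarrow> (nat \<Rightarrow> 'm set) \<Rightarrow> (nat \<Rightarrow> 'm set) \<Rightarrow>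
   (nat \<Rightarrow> 'm set) \<Rightarrow> (nat \<Rightarrow> 'm set) \<Rightarrow> (nat \<Rightarrow> 'm set)" where
  "flag_add scale k e f a b =
     flag_chart scale k e (\<lambda>v. flag_log scale k e f a v + flag_log scale k e f b v)"

definition flag_smul ::
  "('k::comm_ring_1 \<Rightarrow> 'm::ab_group_add \<Rightarrow> 'm) \<Rightarrow> nat \<Rightarrow> (nat \<Rightarrow> 'm set) \<Rightarrow> (nat \<Rightarrow> 'm set) \<Rightarrow>
   'k \<Rightarrow> (nat \<Rightarrow> 'm set) \<Rightarrow> (nat \<Rightarrow> 'm set)" where
  "flag_smul scale k e f r a = flag_chart scale k e (\<lambda>v. scale r (flag_log scale k e f a v))"

text \<open>Transversality of flags is symmetric, so the module structure on the copoint side is the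
  one on the point side with the two flags exchanged.\<close>

definition flag_geometry ::
  "('k::comm_ring_1 \<Rightarrow> 'm::ab_group_add \<Rightarrow> 'm) \<Rightarrow> nat \<Rightarrow>
   ('k, nat \<Rightarrow> 'm set, nat \<Rightarrow> 'm set) pair_geometry" where
  "flag_geometry scale k =
     \<lparr>points = complemented_flags scale k,
      copoints = complemented_flags scale k,
      transv = flag_transversal scale k,
      add_pt = (\<lambda>e f. flag_add scale k e f),
      smul_pt = (\<lambda>e f. flag_smul scale k e f),
      add_co = (\<lambda>e f. flag_add scale k f e),
      smul_co = (\<lambda>e f. flag_smul scale k f e)\<rparr>"

definition bilinear_form ::
  "('k::comm_ring_1 \<Rightarrow> 'm::ab_group_add \<Rightarrow> 'm) \<Rightarrow> ('m \<Rightarrow> 'm \<Rightarrow> 'k) \<Rightarrow> bool" where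
  "bilinear_form scale \<beta> \<longleftrightarrow>
     (\<forall>v. module_hom scale (*) (\<lambda>w. \<beta> v w)) \<and> (\<forall>w. module_hom scale (*) (\<lambda>v. \<beta> v w))"

definition strongly_nondegenerate ::
  "('k::comm_ring_1 \<Rightarrow> 'm::ab_group_add \<Rightarrow> 'm) \<Rightarrow> ('m \<Rightarrow> 'm \<Rightarrow> 'k) \<Rightarrow> bool" where
  "strongly_nondegenerate scale \<beta> \<longleftrightarrow> bij_betw (\<lambda>v. \<beta> v) UNIV {\<phi>. module_hom scale (*) \<phi>}"

definition symmetric_form :: "('m \<Rightarrow> 'm \<Rightarrow> 'k) \<Rightarrow> bool" where
  "symmetric_form \<beta> \<longleftrightarrow> (\<forall>v w. \<beta> v w = \<beta> w v)"

definition skew_symmetric_form :: "('m \<Rightarrow> 'm \<Rightarrow> 'k::comm_ring_1) \<Rightarrow> bool" where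
  "skew_symmetric_form \<beta> \<longleftrightarrow> (\<forall>v w. \<beta> v w = - \<beta> w v)"

definition orth :: "('m \<Rightarrow> 'm \<Rightarrow> 'k::comm_ring_1) \<Rightarrow> 'm set \<Rightarrow> 'm set" where
  "orth \<beta> W = {v. \<forall>w\<in>W. \<beta> v w = 0}"

text \<open>For \<open>j > k\<close> the truncated \<open>k - j\<close> is \<open>0\<close>, so the value is the complement of $f_0 = 0$,
  which is \<open>UNIV\<close> as required of a flag.\<close>

definition flag_orth ::
  "('m \<Rightarrow> 'm \<Rightarrow> 'k::comm_ring_1) \<Rightarrow> nat \<Rightarrow> (nat \<Rightarrow> 'm set) \<Rightarrow> (nat \<Rightarrow> 'm set)" where
  "flag_orth \<beta> k f = (\<lambda>j. orth \<beta> (f (k - j)))"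

definition lagrangian_flag ::
  "('k::comm_ring_1 \<Rightarrow> 'm::ab_group_add \<Rightarrow> 'm) \<Rightarrow> ('m \<Rightarrow> 'm \<Rightarrow> 'k) \<Rightarrow> nat \<Rightarrow> (nat \<Rightarrow> 'm set) \<Rightarrow> bool" where
  "lagrangian_flag scale \<beta> k f \<longleftrightarrow>
     flag scale k f \<and> (\<forall>j\<in>{1..k}. orth \<beta> (f j) = f (k - j))"

definition complemented_lagrangian_flags ::
  "('k::comm_ring_1 \<Rightarrow> 'm::ab_group_add \<Rightarrow> 'm) \<Rightarrow> ('m \<Rightarrow> 'm \<Rightarrow> 'k) \<Rightarrow> nat \<Rightarrow> (nat \<Rightarrow> 'm set) set" where
  "complemented_lagrangian_flags scale \<beta> k =
     {e. lagrangian_flag scale \<beta> k e \<and>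
         (\<exists>f. lagrangian_flag scale \<beta> k f \<and> flag_transversal scale k e f)}"

definition lagrangian_geometry ::
  "('k::comm_ring_1 \<Rightarrow> 'm::ab_group_add \<Rightarrow> 'm) \<Rightarrow> ('m \<Rightarrow> 'm \<Rightarrow> 'k) \<Rightarrow> nat \<Rightarrow>
   ('k, nat \<Rightarrow> 'm set, nat \<Rightarrow> 'm set) pair_geometry" where
  "lagrangian_geometry scale \<beta> k =
     restrict_geometry (flag_geometry scale k)
       (complemented_lagrangian_flags scale \<beta> k) (complemented_lagrangian_flags scale \<beta> k)"

end

theory Submission
  imports Defs
begin

text \<open>The unipotent group $1 + u(f)$ of a flag $f$ acts simply transitively on the flags transversal
  to $f$, because a transversal pair is the same thing as a grading of $m$. The exponential is a
  bijection from $u(f)$ onto this group, since $\exp X - \exp Y$ agrees with $X - Y$ to leading order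
  in the filtration of $\mathrm{End}(m)$ by $f$; this gives the charts. If $X^*$ is the adjoint of $X$,
  then $(\exp(X) e)^\perp = \exp(-X^*) e^\perp$, so in the charts the map $\perp$ is the linear map
  $X \mapsto -X^*$. A fixed flag has a fixed transversal flag, namely the midpoint of $f$ and
  $f^\perp$ for an arbitrary transversal flag $f$.\<close>

text \<open>Products of exponentials of non-commuting nilpotent maps have no usable closed form
  here: only the factorials below \<open>k\<close> are units. The exponential law is therefore used
  only for multiples of a single endomorphism. Everything about composition is done in the group of
  maps \<open>1 + N\<close>, where closure under products is plain algebra, and is carried over to
  \<open>u(f)\<close> by the bijectivity of \<open>exp\<close>. Over a ring a submodule can be
  smaller than its double orthogonal. Equality holds for direct summands, because the adjoint of a
  projection is a projection. So the results on \<open>\<perp>\<close> are stated for one flag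
  together with a transversal partner, even when the partner does not occur in the conclusion.
  Strong non-degeneracy supplies the adjoints. In the charts at a transversal pair fixed by
  \<open>\<perp>\<close>, the Lagrangian flags are the fixed vectors of a linear map, hence a
  submodule. What linearity does not give is a fixed partner for a fixed flag; the midpoint
  construction provides it, and this is where 2 is halved.\<close>

section \<open>Units, transport of module structures, and the filtration of endomorphisms\<close>

lemma unit_inverse_right:
  assumes "(a :: 'k::comm_ring_1) dvd 1"
  shows "a * unit_inverse a = 1"
proof -
  obtain b where b: "a * b = 1"
    using assms by (metis dvdE)
  have "b' = b" if "a * b' = 1" for b'
  proof -
    have "b' = b' * (a * b)" using b by simp
    also have "\<dots> = (a * b') * b" by (simp add: ac_simps)
    finally show ?thesis using that by simp
  qed
  then show ?thesis
    unfolding unit_inverse_def using b theI[of "\<lambda>b. a * b = 1" b] by blast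
qed

lemma unit_inverse_1: "unit_inverse (1 :: 'k::comm_ring_1) = 1"
  using unit_inverse_right[of "1 :: 'k"] by simp

lemma of_nat_fact_dvd_1:
  assumes "\<forall>i. 2 \<le> i \<and> i < k \<longrightarrow> (of_nat i :: 'k::comm_ring_1) dvd 1"
  shows "n < k \<Longrightarrow> (of_nat (fact n) :: 'k) dvd 1"
proof (induction n)
  case (Suc n)
  have "(of_nat (Suc n) :: 'k) dvd 1"
  proof (cases "n = 0")
    case False
    then show ?thesis using assms[rule_format, of "Suc n"] Suc.prems by linarith
  qed simp
  with Suc have "(of_nat (Suc n) :: 'k) * of_nat (fact n) dvd 1 * 1"
    by (intro mult_dvd_mono) auto
  then show ?case
    by (simp add: algebra_simps)
qed simp

text \<open>Transport of structure along mutually inverse maps \<open>\<phi>\<close> and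
  \<open>L\<close>. With \<open>\<phi>\<close> a chart and \<open>L\<close> its logarithm, the
  transported operations are \<open>flag_add\<close> and \<open>flag_smul\<close>.\<close>

lemma module_on_transport:
  assumes U: "module_on U u add smul"
    and \<phi>: "\<And>X. X \<in> U \<Longrightarrow> \<phi> X \<in> V" "\<And>X. X \<in> U \<Longrightarrow> L (\<phi> X) = X"
    and L: "\<And>a. a \<in> V \<Longrightarrow> L a \<in> U" "\<And>a. a \<in> V \<Longrightarrow> \<phi> (L a) = a"
  shows "module_on V (\<phi> u) (\<lambda>a b. \<phi> (add (L a) (L b))) (\<lambda>r a. \<phi> (smul r (L a)))"
proof -
  note U' = U[unfolded module_on_def]
  have c: "u \<in> U" "\<And>a b. a \<in> U \<Longrightarrow> b \<in> U \<Longrightarrow> add a b \<in> U" "\<And>r a. a \<in> U \<Longrightarrow> smul r a \<in> U"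
    using U' by simp_all
  have e: "\<And>a b c. a \<in> U \<Longrightarrow> b \<in> U \<Longrightarrow> c \<in> U \<Longrightarrow> add (add a b) c = add a (add b c)"
    "\<And>a. a \<in> U \<Longrightarrow> add u a = a"
    "\<And>r a b. a \<in> U \<Longrightarrow> b \<in> U \<Longrightarrow> smul r (add a b) = add (smul r a) (smul r b)"
    "\<And>r s a. a \<in> U \<Longrightarrow> smul (r + s) a = add (smul r a) (smul s a)"
    "\<And>r s a. a \<in> U \<Longrightarrow> smul r (smul s a) = smul (r * s) a"
    "\<And>a. a \<in> U \<Longrightarrow> smul 1 a = a"
    using U' by blast+
  have comm: "\<And>a b. a \<in> U \<Longrightarrow> b \<in> U \<Longrightarrow> add a b = add b a"
    using U' by blast
  have inv: "\<exists>b\<in>V. \<phi> (add (L a) (L b)) = \<phi> u" if "a \<in> V" for a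
  proof -
    have "\<forall>A\<in>U. \<exists>B\<in>U. add A B = u"
      using U' by (elim conjE)
    with L(1)[OF \<open>a \<in> V\<close>] obtain B where "B \<in> U" "add (L a) B = u"
      by blast
    then show ?thesis
      using \<phi> by (intro bexI[of _ "\<phi> B"]) auto
  qed
  show ?thesis
    unfolding module_on_def
    by (intro conjI ballI allI inv) (simp_all add: \<phi> L c e, simp add: comm L)
qed

text \<open>The index shift \<open>d\<close> filters the algebra of endomorphisms preserving \<open>f\<close>; for \<open>d = 1\<close> one
  gets the nilradical.\<close>

definition flag_lower ::
  "('k::comm_ring_1 \<Rightarrow> 'm::ab_group_add \<Rightarrow> 'm) \<Rightarrow> nat \<Rightarrow> (nat \<Rightarrow> 'm set) \<Rightarrow> nat \<Rightarrow> ('m \<Rightarrow> 'm) set" where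
  "flag_lower scale k f d = {X. module_hom scale scale X \<and> (\<forall>i\<le>k. \<forall>v\<in>f i. X v \<in> f (i - d))}"

text \<open>The projection onto \<open>A\<close> with kernel \<open>B\<close>; meaningful once
  \<open>m\<close> is the direct sum of the two submodules.\<close>

definition direct_sum_proj :: "'m::ab_group_add set \<Rightarrow> 'm set \<Rightarrow> 'm \<Rightarrow> 'm" where
  "direct_sum_proj A B v = (THE a. a \<in> A \<and> v - a \<in> B)"

lemma direct_sum_UNIV_commute: "direct_sum_UNIV A B \<longleftrightarrow> direct_sum_UNIV B A"
  unfolding direct_sum_UNIV_def by (metis Int_commute add.commute)

section \<open>Endomorphisms and the projections of a direct sum\<close>

locale endomorphism_module = module scale
  for scale :: "'k::comm_ring_1 \<Rightarrow> 'm::ab_group_add \<Rightarrow> 'm"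
begin

abbreviation endo :: "('m \<Rightarrow> 'm) \<Rightarrow> bool" where
  "endo \<equiv> module_hom scale scale"

lemma endo_iff:
  "endo X \<longleftrightarrow> (\<forall>v w. X (v + w) = X v + X w) \<and> (\<forall>r v. X (scale r v) = scale r (X v))"
  using module_axioms by (auto simp: module_hom_iff)

lemma endo_funpow: "endo X \<Longrightarrow> endo (X ^^ n)"
  by (induction n) (auto simp: endo_iff)

lemma endo_comp: "endo X \<Longrightarrow> endo Y \<Longrightarrow> endo (\<lambda>v. X (Y v))"
  by (auto simp: endo_iff)

lemma module_pair_self: "module_pair scale scale"
  by (simp add: module_pair_def module_axioms)

lemmas endo_zero = module_pair.module_hom_zero[OF module_pair_self]
  and endo_add = module_pair.module_hom_add[OF module_pair_self]
  and endo_diff = module_pair.module_hom_sub[OF module_pair_self]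
  and endo_scale = module_pair.module_hom_scale[OF module_pair_self]

lemma endo_sum: "(\<And>i. i \<in> I \<Longrightarrow> endo (X i)) \<Longrightarrow> endo (\<lambda>v. \<Sum>i\<in>I. X i v)"
  by (induction I rule: infinite_finite_induct) (auto intro: endo_zero endo_add)

lemma endo_image_subspace: "endo X \<Longrightarrow> subspace S \<Longrightarrow> subspace (X ` S)"
  by (rule module_hom.subspace_image)

lemma
  assumes "subspace A" "subspace B" "direct_sum_UNIV A B"
  shows direct_sum_proj_in: "direct_sum_proj A B v \<in> A"
    and direct_sum_proj_diff_in: "v - direct_sum_proj A B v \<in> B"
    and direct_sum_proj_eqI: "a \<in> A \<Longrightarrow> v - a \<in> B \<Longrightarrow> direct_sum_proj A B v = a"
proof -
  have uniq: "a = a'" if "a \<in> A" "v - a \<in> B" "a' \<in> A" "v - a' \<in> B" for a a' v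
  proof -
    have "a - a' \<in> A" using that assms by (auto intro: subspace_diff)
    moreover have "(v - a') - (v - a) \<in> B" using that assms by (blast intro: subspace_diff)
    ultimately have "a - a' \<in> A \<inter> B" by simp
    then show ?thesis using assms(3) unfolding direct_sum_UNIV_def by (metis eq_iff_diff_eq_0 singletonD)
  qed
  have ex: "\<exists>a. a \<in> A \<and> v - a \<in> B" for v
    using assms(3) by (metis add_diff_cancel_left' direct_sum_UNIV_def)
  show "direct_sum_proj A B v \<in> A" "v - direct_sum_proj A B v \<in> B"
    using theI'[of "\<lambda>a. a \<in> A \<and> v - a \<in> B"] ex[of v] uniq[of _ v]
    unfolding direct_sum_proj_def by blast+
  then show "a \<in> A \<Longrightarrow> v - a \<in> B \<Longrightarrow> direct_sum_proj A B v = a"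
    using uniq by blast
qed

lemma endo_direct_sum_proj:
  assumes "subspace A" "subspace B" "direct_sum_UNIV A B"
  shows "endo (direct_sum_proj A B)"
  unfolding endo_iff
proof (intro conjI allI)
  note p = direct_sum_proj_in[OF assms] direct_sum_proj_diff_in[OF assms]
  let ?p = "direct_sum_proj A B"
  show "?p (v + w) = ?p v + ?p w" for v w
    using subspace_add[OF assms(2) p(2)[of v] p(2)[of w]]
    by (intro direct_sum_proj_eqI[OF assms] subspace_add[OF assms(1)] p) (simp add: algebra_simps)
  show "?p (scale r v) = scale r (?p v)" for r v
    using subspace_scale[OF assms(2) p(2)[of v], of r]
    by (intro direct_sum_proj_eqI[OF assms] subspace_scale[OF assms(1)] p)
      (simp add: scale_right_diff_distrib)
qed

text \<open>The modular law: subtracting its \<open>A\<close>-part from a vector of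
  \<open>A'\<close> leaves an element of \<open>A' \<inter> B\<close>, which is zero.\<close>

lemma direct_sum_UNIV_subset_eq:
  assumes "direct_sum_UNIV A B" "direct_sum_UNIV A' B" "A \<subseteq> A'" "subspace A'"
  shows "A = A'"
proof
  show "A' \<subseteq> A"
  proof
    fix v assume v: "v \<in> A'"
    obtain a b where ab: "a \<in> A" "b \<in> B" "v = a + b"
      using assms(1) unfolding direct_sum_UNIV_def by metis
    have "v - a \<in> A'" using v ab(1) assms(3,4) by (blast intro: subspace_diff)
    then have "b \<in> A'" using ab(3) by simp
    then have "b = 0" using ab assms(2) by (auto simp: direct_sum_UNIV_def)
    then show "v \<in> A" using ab by simp
  qed
qed fact

lemma direct_sum_UNIV_image:
  assumes "endo g" "bij g" "direct_sum_UNIV A B"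
  shows "direct_sum_UNIV (g ` A) (g ` B)"
  unfolding direct_sum_UNIV_def
proof (intro conjI allI)
  have "g ` A \<inter> g ` B = g ` (A \<inter> B)"
    using assms(2) by (simp add: image_Int bij_is_inj)
  also have "\<dots> = {0}"
    using assms by (simp add: direct_sum_UNIV_def module_hom.zero)
  finally show "g ` A \<inter> g ` B = {0}" .
  fix v
  obtain u where "v = g u" using assms(2) by (metis bij_pointE)
  moreover obtain a b where "a \<in> A" "b \<in> B" "u = a + b"
    using assms(3) unfolding direct_sum_UNIV_def by blast
  ultimately show "\<exists>a\<in>g ` A. \<exists>b\<in>g ` B. v = a + b"
    using assms(1) by (auto simp: module_hom.add)
qed

subsection \<open>Flags\<close>

lemma flag_0: "flag scale k f \<Longrightarrow> f 0 = {0}"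
  and flag_top: "flag scale k f \<Longrightarrow> k \<le> i \<Longrightarrow> f i = UNIV"
  by (simp_all add: flag_def)

lemma flag_subspace: "flag scale k f \<Longrightarrow> subspace (f i)"
  by (cases "i \<le> k") (auto simp: flag_def)

lemma flag_mono:
  assumes "flag scale k f" "i \<le> j"
  shows "f i \<subseteq> f j"
proof -
  have "f n \<subseteq> f (Suc n)" for n
    using assms(1) by (cases "n < k") (auto simp: flag_def)
  then show ?thesis using assms(2) by (rule lift_Suc_mono_le)
qed

lemma flag_mem_mono: "flag scale k f \<Longrightarrow> v \<in> f i \<Longrightarrow> i \<le> j \<Longrightarrow> v \<in> f j"
  using flag_mono by blast

text \<open>Level 0 is automatic from \<open>e 0 = {0}\<close> and \<open>f k = UNIV\<close>.
  Including it makes the index range invariant under \<open>i \<mapsto> k - i\<close>, on which the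
  symmetry of transversality rests.\<close>

lemma flag_transversal_iff:
  "flag_transversal scale k e f \<longleftrightarrow>
     flag scale k e \<and> flag scale k f \<and> (\<forall>i\<le>k. direct_sum_UNIV (e i) (f (k - i)))"
proof -
  have "direct_sum_UNIV (e 0) (f (k - 0))" if "flag scale k e" "flag scale k f"
    using that by (simp add: flag_0 flag_top direct_sum_UNIV_def)
  then show ?thesis
    unfolding flag_transversal_def
    by (metis One_nat_def Suc_leI atLeastAtMost_iff bot_nat_0.not_eq_extremum)
qed

lemma flag_transversal_commute:
  "flag_transversal scale k e f \<longleftrightarrow> flag_transversal scale k f e"
  unfolding flag_transversal_iff
  by (metis diff_diff_cancel diff_le_self direct_sum_UNIV_commute)

lemma flag_transversal_complemented1:
  "flag_transversal scale k e f \<Longrightarrow> e \<in> complemented_flags scale k"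
  unfolding complemented_flags_def by (blast intro: flag_transversal_def[THEN iffD1, THEN conjunct1])

lemma flag_transversal_complemented2:
  "flag_transversal scale k e f \<Longrightarrow> f \<in> complemented_flags scale k"
  using flag_transversal_complemented1 flag_transversal_commute by blast

lemma flag_flag_act:
  assumes "endo g" "bij g" "flag scale k e"
  shows "flag scale k (flag_act g e)"
  unfolding flag_def flag_act_def
proof (intro conjI allI impI)
  show "g ` e 0 = {0}" using assms by (simp add: flag_0 module_hom.zero)
  show "g ` e i = UNIV" if "k \<le> i" for i using assms that by (simp add: flag_top bij_is_surj)
  show "subspace (g ` e i)" for i using assms by (intro endo_image_subspace flag_subspace)
  show "g ` e i \<subset> g ` e (Suc i)" if "i < k" for i
    using assms that
    by (intro image_strict_mono inj_on_subset[OF bij_is_inj subset_UNIV]) (auto simp: flag_def)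
qed

lemma flag_transversal_flag_act:
  assumes "endo g" "bij g" "flag_transversal scale k e f"
  shows "flag_transversal scale k (flag_act g e) (flag_act g f)"
  using assms
  by (auto simp: flag_transversal_iff flag_flag_act)
    (simp add: flag_act_def direct_sum_UNIV_image)

text \<open>At each level \<open>e i\<close> and \<open>a i\<close> are complements of the same
  \<open>f (k - i)\<close>, so one inclusion forces equality.\<close>

lemma flag_transversal_eqI:
  assumes "flag_transversal scale k e f" "flag_transversal scale k a f"
    and "\<And>i. i \<le> k \<Longrightarrow> e i \<subseteq> a i"
  shows "e = a"
proof
  fix i
  show "e i = a i"
  proof (cases "i \<le> k")
    case True
    then show ?thesis
      using assms(1,2) unfolding flag_transversal_iff
      by (intro direct_sum_UNIV_subset_eq[of _ "f (k - i)"] assms(3)) (auto intro: flag_subspace)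
  next
    case False
    then show ?thesis
      using assms(1,2) flag_top[of k e i] flag_top[of k a i] by (simp add: flag_transversal_def)
  qed
qed

text \<open>The graded pieces are \<open>e (Suc i) \<inter> f (k - i)\<close>, and
  \<open>E i\<close> is the component of degree \<open>i\<close>. Taking it as the difference of the
  projections onto \<open>e (Suc i)\<close> and \<open>e i\<close> gives linearity at once and makes
  the sum telescope to the identity. The two vanishing properties recover both flags:
  \<open>f j\<close> only has degrees at least \<open>k - j\<close>, and \<open>e j\<close> only
  degrees below \<open>j\<close>.\<close>

lemma flag_transversal_grading:
  assumes "flag_transversal scale k e f"
  obtains E where "\<And>i. i < k \<Longrightarrow> endo (E i)"
    and "\<And>i v. i < k \<Longrightarrow> E i v \<in> e (Suc i) \<inter> f (k - i)"
    and "\<And>v. (\<Sum>i<k. E i v) = v"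
    and "\<And>i j v. i < k \<Longrightarrow> j \<le> k \<Longrightarrow> v \<in> f j \<Longrightarrow> i < k - j \<Longrightarrow> E i v = 0"
    and "\<And>i j v. i < k \<Longrightarrow> v \<in> e j \<Longrightarrow> j \<le> i \<Longrightarrow> E i v = 0"
proof -
  have fl: "flag scale k e" "flag scale k f"
    using assms by (auto simp: flag_transversal_def)
  define p where "p i = direct_sum_proj (e i) (f (k - i))" for i
  have ds: "subspace (e i)" "subspace (f (k - i))" "direct_sum_UNIV (e i) (f (k - i))"
    if "i \<le> k" for i
    using assms fl that by (auto simp: flag_transversal_iff intro: flag_subspace)
  have p: "p i v \<in> e i" "v - p i v \<in> f (k - i)" "endo (p i)"
    and p_eqI: "a \<in> e i \<Longrightarrow> v - a \<in> f (k - i) \<Longrightarrow> p i v = a" if "i \<le> k" for i a v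
    using direct_sum_proj_in[OF ds[OF that]] direct_sum_proj_diff_in[OF ds[OF that]]
      endo_direct_sum_proj[OF ds[OF that]] direct_sum_proj_eqI[OF ds[OF that]]
    by (simp_all add: p_def)
  have p_e: "p i v = v" if "i \<le> k" "v \<in> e i" for i v
    using that ds by (intro p_eqI) (auto intro: subspace_0)
  have p_f: "p i v = 0" if "i \<le> k" "v \<in> f (k - i)" for i v
    using that ds by (intro p_eqI) (auto intro: subspace_0)
  define E where "E i v = p (Suc i) v - p i v" for i v
  show thesis
  proof (rule that)
    show "endo (E i)" if "i < k" for i
      using that p unfolding E_def by (intro endo_diff) auto
    show "E i v \<in> e (Suc i) \<inter> f (k - i)" if "i < k" for i v
    proof
      show "E i v \<in> e (Suc i)"
        unfolding E_def using that p(1)[of "Suc i" v] p(1)[of i v]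
        by (intro subspace_diff[OF flag_subspace[OF fl(1)]])
          (auto intro: flag_mem_mono[OF fl(1), of _ i])
      have "(v - p i v) - (v - p (Suc i) v) \<in> f (k - i)"
        using that
        by (intro subspace_diff[OF flag_subspace[OF fl(2)] p(2)
              flag_mem_mono[OF fl(2) p(2)[of "Suc i" v]]]) auto
      then show "E i v \<in> f (k - i)" by (simp add: E_def)
    qed
    show "(\<Sum>i<k. E i v) = v" for v
      using p_e[of k v] p_f[of 0 v] fl
      by (simp add: E_def sum_lessThan_telescope[of "\<lambda>i. p i v"] flag_top)
    show "E i v = 0" if "i < k" "j \<le> k" "v \<in> f j" "i < k - j" for i j v
      using that flag_mem_mono[OF fl(2), of v j] by (simp add: E_def p_f)
    show "E i v = 0" if "i < k" "v \<in> e j" "j \<le> i" for i j v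
      using that flag_mem_mono[OF fl(1), of v j] by (simp add: E_def p_e)
  qed
qed

subsection \<open>The unipotent group of a flag\<close>

text \<open>The additional level \<open>i = 0\<close> is harmless: \<open>f 0 = {0}\<close>, and
  \<open>0 - 1 = 0\<close> in the naturals.\<close>

lemma flag_nilradical_eq_lower: "flag scale k f \<Longrightarrow> flag_nilradical scale k f = flag_lower scale k f 1"
proof -
  assume f: "flag scale k f"
  have "X v \<in> f (i - 1)" if "endo X" "\<forall>i\<in>{1..k}. X ` f i \<subseteq> f (i - 1)" "i \<le> k" "v \<in> f i" for X i v
    using that f by (cases "i = 0") (auto simp: flag_0 module_hom.zero image_subset_iff)
  then show ?thesis
    unfolding flag_nilradical_def flag_lower_def by fastforce
qed

lemma flag_lowerD: "X \<in> flag_lower scale k f d \<Longrightarrow> i \<le> k \<Longrightarrow> v \<in> f i \<Longrightarrow> X v \<in> f (i - d)"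
  by (simp add: flag_lower_def)

lemma flag_lower_comp:
  assumes "X \<in> flag_lower scale k f c" "Y \<in> flag_lower scale k f d"
  shows "(\<lambda>v. X (Y v)) \<in> flag_lower scale k f (c + d)"
  unfolding flag_lower_def
proof (intro CollectI conjI allI impI ballI)
  fix i v assume "i \<le> k" "v \<in> f i"
  then have "Y v \<in> f (i - d)" using assms by (auto simp: flag_lower_def)
  then have "X (Y v) \<in> f (i - d - c)"
    using assms(1) \<open>i \<le> k\<close> by (intro flag_lowerD[of X k f c "i - d" "Y v"]) auto
  then show "X (Y v) \<in> f (i - (c + d))" by (simp add: add.commute)
qed (use assms in \<open>auto simp: flag_lower_def intro: endo_comp\<close>)

lemma flag_lower_antimono:
  assumes "flag scale k f" "d \<le> c" "X \<in> flag_lower scale k f c"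
  shows "X \<in> flag_lower scale k f d"
  unfolding flag_lower_def
proof (intro CollectI conjI allI impI ballI)
  fix i v assume "i \<le> k" "v \<in> f i"
  then have "X v \<in> f (i - c)" using assms(3) by (auto simp: flag_lower_def)
  then show "X v \<in> f (i - d)" using assms(1,2) by (simp add: flag_mem_mono[OF assms(1), of "X v" "i - c"])
qed (use assms in \<open>auto simp: flag_lower_def\<close>)

context
  fixes k :: nat and f :: "nat \<Rightarrow> 'm set"
  assumes f: "flag scale k f"
begin

lemma flag_lower_zero: "(\<lambda>v. 0) \<in> flag_lower scale k f d"
  by (auto simp: flag_lower_def intro: endo_zero subspace_0 flag_subspace[OF f])

lemma flag_lower_add:
  "X \<in> flag_lower scale k f d \<Longrightarrow> Y \<in> flag_lower scale k f d \<Longrightarrow> (\<lambda>v. X v + Y v) \<in> flag_lower scale k f d"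
  by (auto simp: flag_lower_def intro: endo_add subspace_add flag_subspace[OF f])

lemma flag_lower_diff:
  "X \<in> flag_lower scale k f d \<Longrightarrow> Y \<in> flag_lower scale k f d \<Longrightarrow> (\<lambda>v. X v - Y v) \<in> flag_lower scale k f d"
  by (auto simp: flag_lower_def intro: endo_diff subspace_diff flag_subspace[OF f])

lemma flag_lower_scale:
  "X \<in> flag_lower scale k f d \<Longrightarrow> (\<lambda>v. scale r (X v)) \<in> flag_lower scale k f d"
  by (auto simp: flag_lower_def intro: endo_scale subspace_scale flag_subspace[OF f])

lemma flag_lower_sum:
  "(\<And>i. i \<in> I \<Longrightarrow> X i \<in> flag_lower scale k f d) \<Longrightarrow> (\<lambda>v. \<Sum>i\<in>I. X i v) \<in> flag_lower scale k f d"
  by (induction I rule: infinite_finite_induct) (auto intro: flag_lower_zero flag_lower_add)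

lemma flag_lower_funpow: "X \<in> flag_lower scale k f 1 \<Longrightarrow> X ^^ n \<in> flag_lower scale k f n"
proof (induction n)
  case 0
  then show ?case by (auto simp: flag_lower_def endo_iff)
next
  case (Suc n)
  then show ?case using flag_lower_comp[of X k f 1 "X ^^ n" n] by (simp add: comp_def)
qed

text \<open>Such a shift sends \<open>f k = UNIV\<close> into \<open>f 0 = {0}\<close>. This is what
  terminates the inductions along the filtration.\<close>

lemma flag_lower_ge: "k \<le> d \<Longrightarrow> X \<in> flag_lower scale k f d \<Longrightarrow> X v = 0"
  using f by (force simp: flag_lower_def flag_0 flag_top)

text \<open>From \<open>X^(n+1) - Y^(n+1) = X (X^n - Y^n) + (X - Y) Y^n\<close>. For exponents at
  least 2 both summands contain a further nilpotent factor, which gains one degree.\<close>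

lemma flag_lower_funpow_diff:
  assumes X: "X \<in> flag_lower scale k f 1" and Y: "Y \<in> flag_lower scale k f 1"
    and D: "(\<lambda>v. X v - Y v) \<in> flag_lower scale k f d"
  shows "(\<lambda>v. (X ^^ n) v - (Y ^^ n) v) \<in> flag_lower scale k f d"
    and "2 \<le> n \<Longrightarrow> (\<lambda>v. (X ^^ n) v - (Y ^^ n) v) \<in> flag_lower scale k f (Suc d)"
proof -
  have X_add: "X (v - w) = X v - X w" for v w
    using X by (auto simp: flag_lower_def module_hom.diff)
  have step: "(\<lambda>v. (X ^^ Suc n) v - (Y ^^ Suc n) v) =
      (\<lambda>v. X ((X ^^ n) v - (Y ^^ n) v) + (X ((Y ^^ n) v) - Y ((Y ^^ n) v)))" for n
    by (simp add: X_add)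
  have *: "(\<lambda>v. (X ^^ n) v - (Y ^^ n) v) \<in> flag_lower scale k f d" for n
  proof (induction n)
    case 0
    show ?case using flag_lower_zero by simp
  next
    case (Suc n)
    show ?case
      unfolding step
      by (intro flag_lower_add) (rule flag_lower_antimono[OF f _ flag_lower_comp[OF X Suc]]
        flag_lower_antimono[OF f _ flag_lower_comp[OF D flag_lower_funpow[OF Y, of n]]]; simp)+
  qed
  then show "(\<lambda>v. (X ^^ n) v - (Y ^^ n) v) \<in> flag_lower scale k f d" .
  assume "2 \<le> n"
  then obtain m where n: "n = Suc (Suc m)"
    by (metis add_2_eq_Suc le_Suc_ex)
  show "(\<lambda>v. (X ^^ n) v - (Y ^^ n) v) \<in> flag_lower scale k f (Suc d)"
    unfolding n step[of "Suc m"]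
    by (intro flag_lower_add) (rule flag_lower_antimono[OF f _ flag_lower_comp[OF X *[of "Suc m"]]]
      flag_lower_antimono[OF f _ flag_lower_comp[OF D flag_lower_funpow[OF Y, of "Suc m"]]]; simp)+
qed

end

text \<open>The map \<open>1 + N\<close> projects each component \<open>E i v\<close>, which lies in
  \<open>f (k - i)\<close>, onto \<open>a (Suc i)\<close> along \<open>f (k - Suc i)\<close>. The
  change is one level deeper in \<open>f\<close>, so \<open>N\<close> is in the nilradical, while
  the image sits in the right level of \<open>a\<close>.\<close>

lemma flag_nilradical_transitive:
  assumes ef: "flag_transversal scale k e f" and af: "flag_transversal scale k a f"
  obtains N where "N \<in> flag_nilradical scale k f" "\<And>i v. i \<le> k \<Longrightarrow> v \<in> e i \<Longrightarrow> v + N v \<in> a i"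
proof -
  have fl: "flag scale k e" "flag scale k f" "flag scale k a"
    using ef af by (auto simp: flag_transversal_def)
  obtain E where E: "\<And>i. i < k \<Longrightarrow> endo (E i)"
    "\<And>i v. i < k \<Longrightarrow> E i v \<in> e (Suc i) \<inter> f (k - i)"
    "\<And>v. (\<Sum>i<k. E i v) = v"
    "\<And>i j v. i < k \<Longrightarrow> j \<le> k \<Longrightarrow> v \<in> f j \<Longrightarrow> i < k - j \<Longrightarrow> E i v = 0"
    "\<And>i j v. i < k \<Longrightarrow> v \<in> e j \<Longrightarrow> j \<le> i \<Longrightarrow> E i v = 0"
    by (rule flag_transversal_grading[OF ef]) (rule that)
  define q where "q i = direct_sum_proj (a i) (f (k - i))" for i
  have ds: "subspace (a i)" "subspace (f (k - i))" "direct_sum_UNIV (a i) (f (k - i))"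
    if "i \<le> k" for i
    using af fl that by (auto simp: flag_transversal_iff intro: flag_subspace)
  have q: "q i v \<in> a i" "v - q i v \<in> f (k - i)" "endo (q i)" if "i \<le> k" for i v
    using direct_sum_proj_in[OF ds[OF that]] direct_sum_proj_diff_in[OF ds[OF that]]
      endo_direct_sum_proj[OF ds[OF that]]
    by (simp_all add: q_def)
  have q0: "q (Suc i) 0 = 0" if "i < k" for i
    using that module_hom.zero[OF q(3)[of "Suc i"]] by simp
  define N where "N v = (\<Sum>i<k. q (Suc i) (E i v) - E i v)" for v
  show thesis
  proof (rule that)
    have "N v \<in> f (j - 1)" if j: "j \<le> k" "v \<in> f j" for j v
      unfolding N_def
    proof (intro subspace_sum[OF flag_subspace[OF fl(2)]])
      fix i assume i: "i \<in> {..<k}"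
      show "q (Suc i) (E i v) - E i v \<in> f (j - 1)"
      \<comment> \<open>Components of degree below \<open>k - j\<close> vanish on
        \<open>f j\<close>; for all others \<open>k - Suc i \<le> j - 1\<close>.\<close>
      proof (cases "i < k - j")
        case True
        then show ?thesis
          using i j by (simp add: E(4)[of i j] q0 subspace_0[OF flag_subspace[OF fl(2)]])
      next
        case False
        have "E i v - q (Suc i) (E i v) \<in> f (k - Suc i)"
          using i by (intro q) auto
        moreover have "f (k - Suc i) \<subseteq> f (j - 1)"
          using False i by (intro flag_mono[OF fl(2)]) auto
        ultimately have "- (E i v - q (Suc i) (E i v)) \<in> f (j - 1)"
          by (intro subspace_neg[OF flag_subspace[OF fl(2)]]) auto
        then show ?thesis by simp
      qed
    qed
    moreover have "endo (\<lambda>v. q (Suc i) (E i v) - E i v)" if "i < k" for i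
      using that by (intro endo_diff endo_comp[of "q (Suc i)" "E i"] E(1) q(3)) auto
    then have "endo N"
      unfolding N_def by (intro endo_sum) simp
    ultimately show "N \<in> flag_nilradical scale k f"
      by (simp add: flag_nilradical_eq_lower[OF fl(2)] flag_lower_def)
    fix j v assume j: "j \<le> k" "v \<in> e j"
    have "v + N v = (\<Sum>i<k. q (Suc i) (E i v))"
      by (simp add: N_def sum_subtractf E(3))
    also have "\<dots> \<in> a j"
    proof (intro subspace_sum[OF flag_subspace[OF fl(3)]])
      fix i assume i: "i \<in> {..<k}"
      show "q (Suc i) (E i v) \<in> a j"
      proof (cases "i < j")
        case True
        then show ?thesis
          using i q(1)[of "Suc i" "E i v"] flag_mono[OF fl(3), of "Suc i" j] by auto
      next
        case False
        then show ?thesis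
          using i j by (simp add: E(5)[of i v j] q0 subspace_0[OF flag_subspace[OF fl(3)]])
      qed
    qed
    finally show "v + N v \<in> a j" .
  qed
qed

text \<open>On the graded piece of degree \<open>i\<close>, \<open>N\<close> takes values in
  \<open>e (Suc i)\<close> by stability and in \<open>f (k - Suc i)\<close> by nilpotency, and these
  two meet in zero.\<close>

lemma flag_nilradical_free:
  assumes ef: "flag_transversal scale k e f" and N: "N \<in> flag_nilradical scale k f"
    and stab: "\<And>i v. i \<le> k \<Longrightarrow> v \<in> e i \<Longrightarrow> v + N v \<in> e i"
  shows "N v = 0"
proof -
  have fl: "flag scale k e" "flag scale k f"
    using ef by (auto simp: flag_transversal_def)
  obtain E where E: "\<And>i v. i < k \<Longrightarrow> E i v \<in> e (Suc i) \<inter> f (k - i)"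
    "\<And>v. (\<Sum>i<k. E i v) = v"
    by (rule flag_transversal_grading[OF ef]) (rule that)
  have N0: "N (E i v) = 0" if i: "i < k" for i
  proof -
    have "(E i v + N (E i v)) - E i v \<in> e (Suc i)"
      using i E(1)[OF i, of v] by (intro subspace_diff[OF flag_subspace[OF fl(1)]] stab) auto
    moreover have "N (E i v) \<in> f (k - Suc i)"
      using N E(1)[OF i, of v] i flag_lowerD[of N k f 1 "k - i" "E i v"]
      by (simp add: flag_nilradical_eq_lower[OF fl(2)])
    moreover have "e (Suc i) \<inter> f (k - Suc i) = {0}"
      using ef i by (auto simp: flag_transversal_iff direct_sum_UNIV_def)
    ultimately show ?thesis by auto
  qed
  have "endo N" using N by (simp add: flag_nilradical_def)
  then have "N (\<Sum>i<k. E i v) = (\<Sum>i<k. N (E i v))" by (rule module_hom.sum)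
  then show ?thesis using N0 E(2) by simp
qed

end

subsection \<open>The exponential\<close>

locale exponential_module = endomorphism_module scale
  for scale :: "'k::comm_ring_1 \<Rightarrow> 'm::ab_group_add \<Rightarrow> 'm" +
  fixes k :: nat
  assumes fact_unit: "n < k \<Longrightarrow> (of_nat (fact n) :: 'k) dvd 1"
    and k_ge_2: "2 \<le> k"
begin

abbreviation inv_fact :: "nat \<Rightarrow> 'k" where
  "inv_fact n \<equiv> unit_inverse (of_nat (fact n))"

abbreviation nexp :: "('m \<Rightarrow> 'm) \<Rightarrow> 'm \<Rightarrow> 'm" where
  "nexp \<equiv> nilpotent_exp scale k"

text \<open>This is \<open>1/(i! j!) = binom(i+j, i)/(i+j)!\<close>, with the bound that makes all
  three factorials units.\<close>

lemma inv_fact_mult: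
  assumes "i + j < k"
  shows "inv_fact i * inv_fact j = of_nat ((i + j) choose i) * inv_fact (i + j)"
proof -
  have u: "of_nat (fact i) * inv_fact i = 1" "of_nat (fact j) * inv_fact j = 1"
    "of_nat (fact (i + j)) * inv_fact (i + j) = 1"
    using assms by (auto intro!: unit_inverse_right fact_unit simp del: of_nat_fact)
  have "fact (i + j) = fact i * fact j * ((i + j) choose i)"
    using binomial_fact_lemma[of i "i + j"] by simp
  then have b: "(of_nat (fact (i + j)) :: 'k) = of_nat (fact i) * of_nat (fact j) * of_nat ((i + j) choose i)"
    by (simp only: of_nat_mult)
  have "inv_fact i * inv_fact j =
      inv_fact i * inv_fact j * (of_nat (fact (i + j)) * inv_fact (i + j))"
    using u(3) by simp
  also have "\<dots> = (of_nat (fact i) * inv_fact i) * (of_nat (fact j) * inv_fact j) *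
      (of_nat ((i + j) choose i) * inv_fact (i + j))"
    unfolding b by (simp only: ac_simps)
  finally show ?thesis using u by (simp del: of_nat_fact)
qed

lemma endo_nexp: "endo X \<Longrightarrow> endo (nexp X)"
  unfolding nilpotent_exp_def by (intro endo_sum endo_scale endo_funpow)

lemma funpow_scale:
  "endo X \<Longrightarrow> ((\<lambda>v. scale r (X v)) ^^ n) v = scale (r ^ n) ((X ^^ n) v)"
  by (induction n) (auto simp: endo_iff mult.commute)

lemma funpow_nilpotent_le:
  assumes "endo X" "\<And>v. (X ^^ k) v = 0" "k \<le> n"
  shows "(X ^^ n) v = 0"
proof -
  have "(X ^^ n) v = (X ^^ (n - k)) ((X ^^ k) v)"
    using assms(3) by (simp flip: funpow_add comp_apply[of "X ^^ (n - k)"])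
  then show ?thesis
    using assms module_hom.zero[OF endo_funpow[OF assms(1)]] by simp
qed

text \<open>Multiples of one endomorphism commute, so the binomial theorem applies to each
  homogeneous part of the product.\<close>

lemma nexp_scale_add:
  assumes X: "endo X" "\<And>v. (X ^^ k) v = 0"
  shows "nexp (\<lambda>v. scale r (X v)) (nexp (\<lambda>v. scale s (X v)) v) = nexp (\<lambda>v. scale (r + s) (X v)) v"
proof -
  define F where "F i j = scale (inv_fact i * r ^ i * (inv_fact j * s ^ j)) ((X ^^ (i + j)) v)" for i j
  have F0: "F i j = 0" if "k \<le> i + j" for i j
    using funpow_nilpotent_le[OF X that] by (simp add: F_def)
  have X_sum: "(X ^^ i) (\<Sum>j\<in>J. g j) = (\<Sum>j\<in>J. (X ^^ i) (g j))" for i J and g :: "nat \<Rightarrow> 'm"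
    using module_hom.sum[OF endo_funpow[OF X(1)]] .
  have X_scale: "(X ^^ i) (scale a w) = scale a ((X ^^ i) w)" for i a w
    using module_hom.scale[OF endo_funpow[OF X(1)]] .
  have "nexp (\<lambda>v. scale r (X v)) (nexp (\<lambda>v. scale s (X v)) v) = (\<Sum>i<k. \<Sum>j<k. F i j)"
    unfolding nilpotent_exp_def F_def
    by (simp add: funpow_scale[OF X(1)] X_sum X_scale scale_sum_right funpow_add mult.assoc)
  also have "\<dots> = (\<Sum>(i, j)\<in>{..<k} \<times> {..<k}. F i j)"
    by (rule sum.cartesian_product)
  \<comment> \<open>The square of index pairs shrinks to a triangle because
    \<open>X ^^ (i + j)\<close> vanishes outside it; the coefficient identity is available only
    inside.\<close>
  also have "\<dots> = (\<Sum>(i, j)\<in>{(i, j). i + j < k}. F i j)"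
    by (rule sum.mono_neutral_right) (auto, metis F0 not_less)
  also have "\<dots> = (\<Sum>n<k. \<Sum>i\<le>n. F i (n - i))"
    by (rule sum.triangle_reindex)
  also have "\<dots> = (\<Sum>n<k. scale (inv_fact n) (((\<lambda>v. scale (r + s) (X v)) ^^ n) v))"
  proof (intro sum.cong refl)
    fix n assume n: "n \<in> {..<k}"
    have "F i (n - i) = scale (inv_fact n * (of_nat (n choose i) * r ^ i * s ^ (n - i))) ((X ^^ n) v)"
      if "i \<le> n" for i
    proof -
      have "inv_fact i * inv_fact (n - i) = of_nat (n choose i) * inv_fact n"
        using inv_fact_mult[of i "n - i"] that n by simp
      moreover have "inv_fact i * r ^ i * (inv_fact (n - i) * s ^ (n - i)) =
          (inv_fact i * inv_fact (n - i)) * (r ^ i * s ^ (n - i))"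
        by (simp only: ac_simps)
      moreover have "of_nat (n choose i) * inv_fact n * (r ^ i * s ^ (n - i)) =
          inv_fact n * (of_nat (n choose i) * r ^ i * s ^ (n - i))"
        by (simp only: ac_simps)
      ultimately show ?thesis using that by (simp add: F_def)
    qed
    then have "(\<Sum>i\<le>n. F i (n - i)) =
        scale (inv_fact n * (\<Sum>i\<le>n. of_nat (n choose i) * r ^ i * s ^ (n - i))) ((X ^^ n) v)"
      by (simp add: scale_sum_left sum_distrib_left)
    then show "(\<Sum>i\<le>n. F i (n - i)) = scale (inv_fact n) (((\<lambda>v. scale (r + s) (X v)) ^^ n) v)"
      by (simp add: funpow_scale[OF X(1)] binomial_ring)
  qed
  finally show ?thesis by (simp add: nilpotent_exp_def)
qed

lemma nexp_zero: "nexp (\<lambda>v. 0) v = v"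
proof -
  have "nexp (\<lambda>v. 0) v = (\<Sum>i<k. if i = 0 then v else 0)"
    unfolding nilpotent_exp_def
    by (intro sum.cong refl) (auto simp: unit_inverse_1 gr0_conv_Suc)
  then show ?thesis using k_ge_2 by simp
qed

lemma
  assumes "endo X" "\<And>v. (X ^^ k) v = 0"
  shows nexp_minus_left: "nexp (\<lambda>v. - X v) (nexp X v) = v"
    and nexp_minus_right: "nexp X (nexp (\<lambda>v. - X v) v) = v"
  using nexp_scale_add[OF assms, of "- 1" 1] nexp_scale_add[OF assms, of 1 "- 1"]
  by (simp_all add: nexp_zero)

lemma bij_nexp: "endo X \<Longrightarrow> (\<And>v. (X ^^ k) v = 0) \<Longrightarrow> bij (nexp X)"
  by (rule o_bij[of "nexp (\<lambda>v. - X v)"]) (auto simp: nexp_minus_left nexp_minus_right)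

context
  fixes f
  assumes f: "flag scale k f"
begin

lemma flag_lower_1_nilpotent: "X \<in> flag_lower scale k f 1 \<Longrightarrow> (X ^^ k) v = 0"
  using flag_lower_ge[OF f order_refl flag_lower_funpow[OF f]] .

lemma flag_lower_uminus:
  "X \<in> flag_lower scale k f d \<Longrightarrow> (\<lambda>v. - X v) \<in> flag_lower scale k f d"
  using flag_lower_scale[OF f, of X d "- 1"] by simp

text \<open>The terms of order 0 and 1 cancel against \<open>X - Y\<close>, and every later term
  gains a degree by \<open>flag_lower_funpow_diff\<close>.\<close>

lemma nexp_diff_lower:
  assumes X: "X \<in> flag_lower scale k f 1" and Y: "Y \<in> flag_lower scale k f 1"
    and D: "(\<lambda>v. X v - Y v) \<in> flag_lower scale k f d"
  shows "(\<lambda>v. (nexp X v - nexp Y v) - (X v - Y v)) \<in> flag_lower scale k f (Suc d)"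
proof -
  \<comment> \<open>Both low-order terms occur in the truncated series because
    \<open>2 \<le> k\<close>.\<close>
  have k: "{..<k} = insert 0 (insert (Suc 0) {2..<k})"
    using k_ge_2 by auto
  have e: "nexp X v = v + (X v + (\<Sum>i=2..<k. scale (inv_fact i) ((X ^^ i) v)))" for X v
    unfolding nilpotent_exp_def k
    by (simp add: unit_inverse_1)
  have "(\<lambda>v. (nexp X v - nexp Y v) - (X v - Y v)) =
      (\<lambda>v. \<Sum>i=2..<k. scale (inv_fact i) ((X ^^ i) v - (Y ^^ i) v))"
    by (simp add: e sum_subtractf scale_right_diff_distrib)
  also have "\<dots> \<in> flag_lower scale k f (Suc d)"
    by (intro flag_lower_sum[OF f] flag_lower_scale[OF f] flag_lower_funpow_diff(2)[OF f X Y D]) auto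
  finally show ?thesis .
qed

lemma nexp_minus_id_lower:
  assumes X: "X \<in> flag_lower scale k f 1"
  shows "(\<lambda>v. nexp X v - v) \<in> flag_lower scale k f 1"
proof -
  have "(\<lambda>v. (nexp X v - v - X v) + X v) \<in> flag_lower scale k f 1"
    using flag_lower_antimono[OF f _ nexp_diff_lower[OF X flag_lower_zero[OF f], of 1], of 1] X
    by (intro flag_lower_add[OF f]) (simp_all add: nexp_zero)
  then show ?thesis by simp
qed

text \<open>With equal exponentials, \<open>nexp_diff_lower\<close> pushes \<open>X - Y\<close> one
  degree deeper than any degree already known, until it is zero.\<close>

lemma nexp_inj_lower:
  assumes X: "X \<in> flag_lower scale k f 1" and Y: "Y \<in> flag_lower scale k f 1"
    and eq: "nexp X = nexp Y"
  shows "X = Y"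
proof -
  have "(\<lambda>v. X v - Y v) \<in> flag_lower scale k f (Suc d)" for d
  proof (induction d)
    case 0
    show ?case using flag_lower_diff[OF f X Y] by simp
  next
    case (Suc d)
    then show ?case
      using flag_lower_uminus[OF nexp_diff_lower[OF X Y Suc]] by (simp add: eq)
  qed
  from flag_lower_ge[OF f _ this[of k]] show ?thesis
    by (intro ext) (simp add: le_Suc_eq)
qed

text \<open>Successive approximation along the filtration, in place of a truncated logarithm series.\<close>

lemma nexp_surj_lower:
  assumes N: "N \<in> flag_lower scale k f 1"
  obtains X where "X \<in> flag_lower scale k f 1" "\<And>v. nexp X v = v + N v"
proof -
  have "\<exists>X\<in>flag_lower scale k f 1. (\<lambda>v. (v + N v) - nexp X v) \<in> flag_lower scale k f (Suc d)" for d
  proof (induction d)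
    case 0
    show ?case
      using N flag_lower_zero[OF f] by (intro bexI[of _ "\<lambda>v. 0"]) (auto simp: nexp_zero)
  next
    case (Suc d)
    then obtain X where X: "X \<in> flag_lower scale k f 1"
      and D: "(\<lambda>v. (v + N v) - nexp X v) \<in> flag_lower scale k f (Suc d)" by blast
    \<comment> \<open>The current error is added to \<open>X\<close>. The new error is
      \<open>(Y - X) - (exp Y - exp X)\<close>, one degree deeper.\<close>
    define Y where "Y v = X v + ((v + N v) - nexp X v)" for v
    have Y: "Y \<in> flag_lower scale k f 1"
      unfolding Y_def[abs_def]
      by (intro flag_lower_add[OF f] X flag_lower_antimono[OF f _ D]) simp
    have "(\<lambda>v. Y v - X v) \<in> flag_lower scale k f (Suc d)"
      using D by (simp add: Y_def)
    from flag_lower_uminus[OF nexp_diff_lower[OF Y X this]] Y show ?case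
      by (intro bexI[of _ Y]) (auto simp: Y_def)
  qed
  then obtain X where X: "X \<in> flag_lower scale k f 1"
    and "(\<lambda>v. (v + N v) - nexp X v) \<in> flag_lower scale k f (Suc k)" by blast
  from flag_lower_ge[OF f _ this(2)] have "nexp X v = v + N v" for v
    by simp
  with X that show thesis by blast
qed

end

subsection \<open>The chart of a transversal pair\<close>

abbreviation chart where "chart \<equiv> flag_chart scale k"
abbreviation nilrad where "nilrad \<equiv> flag_nilradical scale k"
abbreviation transversal where "transversal \<equiv> flag_transversal scale k"

lemma transversal_flags: "transversal e f \<Longrightarrow> flag scale k e" "transversal e f \<Longrightarrow> flag scale k f"
  by (simp_all add: flag_transversal_def)

text \<open>Invariance under \<open>exp X\<close> alone gives an inclusion, which over a ring need
  not be an equality; the inverse \<open>exp (-X)\<close> supplies the other one.\<close>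

lemma nexp_preserves_flag:
  assumes f: "flag scale k f" and X: "X \<in> nilrad f"
  shows "flag_act (nexp X) f = f"
proof
  fix i
  have sub: "nexp Y ` f i \<subseteq> f i" if "Y \<in> flag_lower scale k f 1" "i \<le> k" for Y
  proof
    fix w assume "w \<in> nexp Y ` f i"
    then obtain v where v: "v \<in> f i" "w = v + (nexp Y v - v)" by auto
    have "nexp Y v - v \<in> f (i - 1)"
      using flag_lowerD[OF nexp_minus_id_lower[OF f that(1)] that(2) v(1)] .
    then show "w \<in> f i"
      unfolding v(2)
      by (intro subspace_add[OF flag_subspace[OF f] v(1)]) (auto intro: flag_mem_mono[OF f])
  qed
  have X1: "X \<in> flag_lower scale k f 1" and eX: "endo X"
    using X by (simp_all add: flag_nilradical_eq_lower[OF f] flag_lower_def)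
  note nil = flag_lower_1_nilpotent[OF f X1]
  show "flag_act (nexp X) f i = f i"
  proof (cases "i \<le> k")
    case True
    have "f i = nexp X ` (nexp (\<lambda>v. - X v) ` f i)"
      by (simp add: image_comp nexp_minus_right[OF eX nil])
    also have "\<dots> \<subseteq> nexp X ` f i"
      by (intro image_mono sub flag_lower_uminus[OF f X1] True)
    finally show ?thesis
      using sub[OF X1 True] by (auto simp: flag_act_def)
  next
    case False
    then show ?thesis
      using bij_nexp[OF eX nil] by (simp add: flag_act_def flag_top[OF f] bij_is_surj)
  qed
qed

text \<open>\<open>exp X\<close> moves the pair \<open>e\<close>, \<open>f\<close> to a transversal
  pair and fixes \<open>f\<close>.\<close>

lemma chart_transversal:
  assumes ef: "transversal e f" and X: "X \<in> nilrad f"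
  shows "transversal (chart e X) f"
proof -
  note f = transversal_flags(2)[OF ef]
  have X1: "X \<in> flag_lower scale k f 1" and eX: "endo X"
    using X by (simp_all add: flag_nilradical_eq_lower[OF f] flag_lower_def)
  show ?thesis
    using flag_transversal_flag_act[OF endo_nexp[OF eX] bij_nexp[OF eX flag_lower_1_nilpotent[OF f X1]] ef]
    by (simp add: flag_chart_def nexp_preserves_flag[OF f X])
qed

lemma chart_surj:
  assumes ef: "transversal e f" and af: "transversal a f"
  obtains X where "X \<in> nilrad f" "chart e X = a"
proof -
  note f = transversal_flags(2)[OF ef]
  obtain N where N: "N \<in> nilrad f" "\<And>i v. i \<le> k \<Longrightarrow> v \<in> e i \<Longrightarrow> v + N v \<in> a i"
    by (rule flag_nilradical_transitive[OF ef af]) (rule that)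
  obtain X where X: "X \<in> nilrad f" "\<And>v. nexp X v = v + N v"
    using N(1) nexp_surj_lower[OF f] by (metis flag_nilradical_eq_lower[OF f])
  have "chart e X = a"
    using N(2) by (intro flag_transversal_eqI[OF chart_transversal[OF ef X(1)] af])
      (auto simp: flag_chart_def flag_act_def X(2))
  with X that show thesis by blast
qed

text \<open>Writing the factors as \<open>1 + L\<close> and \<open>1 + M\<close>, the product is
  \<open>1 + (LM + L + M)\<close>, with the bracket in the nilradical. So
  \<open>flag_nilradical_free\<close> applies without exhibiting the product as an
  exponential.\<close>

lemma nexp_free:
  assumes ef: "transversal e f" and X: "X \<in> nilrad f" and Y: "Y \<in> nilrad f"
    and stab: "\<And>i v. i \<le> k \<Longrightarrow> v \<in> e i \<Longrightarrow> nexp Y (nexp X v) \<in> e i"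
  shows "nexp Y (nexp X v) = v"
proof -
  note f = transversal_flags(2)[OF ef]
  have X1: "X \<in> flag_lower scale k f 1" and Y1: "Y \<in> flag_lower scale k f 1"
    using X Y by (simp_all add: flag_nilradical_eq_lower[OF f])
  define N where "N v = nexp Y (nexp X v) - v" for v
  let ?M = "\<lambda>v. nexp X v - v" and ?L = "\<lambda>v. nexp Y v - v"
  have "endo (nexp Y)" using Y1 by (auto simp: flag_lower_def intro: endo_nexp)
  then have N_eq: "N = (\<lambda>v. (?L (?M v) + ?L v) + ?M v)"
    by (auto simp: N_def module_hom.diff)
  have M1: "?M \<in> flag_lower scale k f 1" "?L \<in> flag_lower scale k f 1"
    using nexp_minus_id_lower[OF f] X1 Y1 by blast+
  have "N \<in> flag_lower scale k f 1"
    unfolding N_eq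
    by (intro flag_lower_add[OF f] M1 flag_lower_antimono[OF f _ flag_lower_comp[OF M1(2,1)]]) simp
  then have "N \<in> nilrad f"
    by (simp add: flag_nilradical_eq_lower[OF f])
  from flag_nilradical_free[OF ef this, of v] stab show ?thesis
    by (simp add: N_def)
qed

lemma nilrad_uminus: "flag scale k f \<Longrightarrow> X \<in> nilrad f \<Longrightarrow> (\<lambda>v. - X v) \<in> nilrad f"
  by (simp add: flag_nilradical_eq_lower flag_lower_uminus)

lemma nilrad_endo: "X \<in> nilrad f \<Longrightarrow> endo X"
  by (simp add: flag_nilradical_def)

lemma nilrad_nilpotent: "flag scale k f \<Longrightarrow> X \<in> nilrad f \<Longrightarrow> (X ^^ k) v = 0"
  by (simp add: flag_nilradical_eq_lower flag_lower_1_nilpotent)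

text \<open>\<open>exp (-Y) exp X\<close> stabilises \<open>e\<close>, hence is the identity by
  freeness, and then \<open>exp\<close> is injective on the nilradical.\<close>

lemma chart_inj:
  assumes ef: "transversal e f" and X: "X \<in> nilrad f" and Y: "Y \<in> nilrad f"
    and eq: "chart e X = chart e Y"
  shows "X = Y"
proof -
  note f = transversal_flags(2)[OF ef]
  let ?Y' = "\<lambda>v. - Y v"
  have left: "nexp ?Y' (nexp Y v) = v" and right: "nexp Y (nexp ?Y' v) = v" for v
    using nexp_minus_left nexp_minus_right nilrad_endo[OF Y] nilrad_nilpotent[OF f Y] by blast+
  have "nexp ?Y' (nexp X v) \<in> e i" if "v \<in> e i" for i v
  proof -
    have "nexp X v \<in> nexp Y ` e i"
      using that fun_cong[OF eq, of i] by (auto simp: flag_chart_def flag_act_def)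
    then show ?thesis using left by auto
  qed
  then have "nexp ?Y' (nexp X v) = v" for v
    using nexp_free[OF ef X nilrad_uminus[OF f Y]] by blast
  then have "nexp X = nexp Y" by (metis right ext)
  then show ?thesis
    by (rule nexp_inj_lower[OF f X[unfolded flag_nilradical_eq_lower[OF f]]
          Y[unfolded flag_nilradical_eq_lower[OF f]]])
qed

lemma flag_log_chart: "transversal e f \<Longrightarrow> X \<in> nilrad f \<Longrightarrow> flag_log scale k e f (chart e X) = X"
  unfolding flag_log_def by (intro the_equality) (auto intro: chart_inj)

lemma flag_log:
  assumes "transversal e f" "transversal a f"
  shows "flag_log scale k e f a \<in> nilrad f" "chart e (flag_log scale k e f a) = a"
proof -
  obtain X where "X \<in> nilrad f" "chart e X = a"
    by (rule chart_surj[OF assms])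
  then show "flag_log scale k e f a \<in> nilrad f" "chart e (flag_log scale k e f a) = a"
    using flag_log_chart[OF assms(1)] by auto
qed

lemma chart_zero: "chart e (\<lambda>v. 0) = e"
  by (simp add: flag_chart_def flag_act_def nexp_zero)

lemma module_on_nilrad:
  assumes f: "flag scale k f"
  shows "module_on (nilrad f) (\<lambda>v. 0) (\<lambda>X Y v. X v + Y v) (\<lambda>r X v. scale r (X v))"
  unfolding module_on_def flag_nilradical_eq_lower[OF f]
proof (intro conjI ballI allI)
  show "\<exists>Y\<in>flag_lower scale k f 1. (\<lambda>v. X v + Y v) = (\<lambda>v. 0)" if "X \<in> flag_lower scale k f 1" for X
    by (rule bexI[OF _ flag_lower_uminus[OF f that]]) simp
qed (auto simp: algebra_simps scale_right_distrib scale_left_distrib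
      intro: flag_lower_zero[OF f] flag_lower_add[OF f] flag_lower_scale[OF f])

lemma module_on_transversal:
  assumes ef: "transversal e f"
  shows "module_on {a \<in> complemented_flags scale k. transversal a f} e
    (flag_add scale k e f) (flag_smul scale k e f)"
  using module_on_transport[OF module_on_nilrad[OF transversal_flags(2)[OF ef]],
      of "chart e" "{a \<in> complemented_flags scale k. transversal a f}" "flag_log scale k e f"]
  by (simp add: chart_zero flag_add_def[abs_def] flag_smul_def[abs_def] flag_log[OF ef]
      flag_log_chart[OF ef] chart_transversal[OF ef] flag_transversal_complemented1[OF chart_transversal[OF ef]])

abbreviation geometry where "geometry \<equiv> flag_geometry scale k"

lemma geometry_simps:
  "points geometry = complemented_flags scale k" "copoints geometry = complemented_flags scale k"
  "transv geometry = transversal"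
  "add_pt geometry e f = flag_add scale k e f" "smul_pt geometry e f = flag_smul scale k e f"
  "add_co geometry e f = flag_add scale k f e" "smul_co geometry e f = flag_smul scale k f e"
  "v_pt geometry f = {a. transversal a f}" "v_co geometry e = {a. transversal a e}"
  using flag_transversal_complemented1 flag_transversal_commute
  by (auto simp: flag_geometry_def v_pt_def v_co_def)

lemma linear_pair_geometry_flags: "linear_pair_geometry geometry"
proof -
  have eq: "{a \<in> complemented_flags scale k. transversal a f} = {a. transversal a f}" for f
    using flag_transversal_complemented1 by auto
  have "module_on {a. transversal a \<alpha>} x (flag_add scale k x \<alpha>) (flag_smul scale k x \<alpha>) \<and>
      module_on {a. transversal a x} \<alpha> (flag_add scale k \<alpha> x) (flag_smul scale k \<alpha> x)"
    if "transversal x \<alpha>" for x \<alpha>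
    using module_on_transversal[OF that] module_on_transversal[of \<alpha> x] that
    by (simp add: eq flag_transversal_commute)
  moreover have "\<exists>\<alpha>\<in>complemented_flags scale k. transversal x \<alpha>"
    if "x \<in> complemented_flags scale k" for x
    using that flag_transversal_complemented2[of k x] unfolding complemented_flags_def by blast
  ultimately show ?thesis
    unfolding linear_pair_geometry_def geometry_simps
    using flag_transversal_complemented1 flag_transversal_complemented2 flag_transversal_commute
    by blast
qed

end

subsection \<open>Adjoints and orthogonal complements\<close>

text \<open>For \<open>k = 2\<close> the factorials below \<open>k\<close> are all 1 and say nothing
  about 2, so \<open>two_unit\<close> is a separate assumption.\<close>

locale form_module = exponential_module scale k
  for scale :: "'k::comm_ring_1 \<Rightarrow> 'm::ab_group_add \<Rightarrow> 'm" and k :: nat +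
  fixes \<beta> :: "'m \<Rightarrow> 'm \<Rightarrow> 'k"
  assumes two_unit: "(2 :: 'k) dvd 1"
    and bilinear: "bilinear_form scale \<beta>"
    and nondegenerate: "strongly_nondegenerate scale \<beta>"
    and symmetric_or_skew: "symmetric_form \<beta> \<or> skew_symmetric_form \<beta>"
begin

lemma form_hom: "module_hom scale (*) (\<beta> v)" "module_hom scale (*) (\<lambda>v. \<beta> v w)"
  using bilinear by (simp_all add: bilinear_form_def)

lemma form_simps:
  "\<beta> (u + v) w = \<beta> u w + \<beta> v w" "\<beta> (u - v) w = \<beta> u w - \<beta> v w" "\<beta> (- v) w = - \<beta> v w"
  "\<beta> (scale r v) w = r * \<beta> v w" "\<beta> 0 w = 0"
  "\<beta> w (u + v) = \<beta> w u + \<beta> w v" "\<beta> w (u - v) = \<beta> w u - \<beta> w v" "\<beta> w (- v) = - \<beta> w v"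
  "\<beta> w (scale r v) = r * \<beta> w v" "\<beta> w 0 = 0"
  by (simp_all add: module_hom.add[OF form_hom(1)] module_hom.add[OF form_hom(2)]
      module_hom.diff[OF form_hom(1)] module_hom.diff[OF form_hom(2)]
      module_hom.neg[OF form_hom(1)] module_hom.neg[OF form_hom(2)]
      module_hom.scale[OF form_hom(1)] module_hom.scale[OF form_hom(2)]
      module_hom.zero[OF form_hom(1)] module_hom.zero[OF form_hom(2)])

lemma form_eqI: "(\<And>w. \<beta> u w = \<beta> v w) \<Longrightarrow> u = v"
  using nondegenerate unfolding strongly_nondegenerate_def bij_betw_def inj_def by blast

text \<open>Flipping both sides at once cancels the sign, so the symmetric and the skew case are
  treated together from here on.\<close>

lemma form_flip_eq: "\<beta> u v = \<beta> u' v' \<longleftrightarrow> \<beta> v u = \<beta> v' u'"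
  using symmetric_or_skew unfolding symmetric_form_def skew_symmetric_form_def
  by (metis neg_equal_iff_equal)

lemma form_flip_0: "\<beta> u v = 0 \<longleftrightarrow> \<beta> v u = 0"
  using form_flip_eq[of u v 0 0] by (simp add: form_simps)

text \<open>For linear \<open>X\<close> the functional \<open>w \<mapsto> \<beta> v (X w)\<close> is
  represented by exactly one vector, by strong non-degeneracy; no basis or finiteness of
  \<open>m\<close> enters.\<close>

definition adj :: "('m \<Rightarrow> 'm) \<Rightarrow> 'm \<Rightarrow> 'm" where
  "adj X v = (THE u. \<forall>w. \<beta> u w = \<beta> v (X w))"

lemma adj:
  assumes "endo X"
  shows "\<beta> (adj X v) w = \<beta> v (X w)"
proof -
  have "module_hom scale (*) (\<lambda>w. \<beta> v (X w))"
    using module_hom_compose[OF assms form_hom(1)] by (simp add: comp_def)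
  then obtain u where "\<beta> u = (\<lambda>w. \<beta> v (X w))"
    using nondegenerate unfolding strongly_nondegenerate_def bij_betw_def
    by (metis (mono_tags, lifting) imageE mem_Collect_eq)
  then have "\<exists>!u. \<forall>w. \<beta> u w = \<beta> v (X w)"
    by (intro ex1I[of _ u]) (auto intro: form_eqI)
  from theI'[OF this] show ?thesis by (simp add: adj_def)
qed

lemma adj_eqI: "endo X \<Longrightarrow> (\<And>w. \<beta> u w = \<beta> v (X w)) \<Longrightarrow> adj X v = u"
  by (rule form_eqI) (simp add: adj)

lemma endo_adj: "endo X \<Longrightarrow> endo (adj X)"
  unfolding endo_iff by (auto intro!: adj_eqI simp: endo_iff form_simps adj)

lemma adj_adj: "endo X \<Longrightarrow> adj (adj X) = X"
proof
  fix v assume X: "endo X"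
  have "\<beta> (X v) w = \<beta> v (adj X w)" for w
    using form_flip_eq[of "X v" w v "adj X w"] adj[OF X, of w v] by simp
  then show "adj (adj X) v = X v"
    by (intro adj_eqI endo_adj X)
qed

lemma adj_add: "endo X \<Longrightarrow> endo Y \<Longrightarrow> adj (\<lambda>v. X v + Y v) = (\<lambda>v. adj X v + adj Y v)"
  by (intro ext adj_eqI endo_add) (simp_all add: form_simps adj)

lemma adj_scale: "endo X \<Longrightarrow> adj (\<lambda>v. scale r (X v)) = (\<lambda>v. scale r (adj X v))"
  by (intro ext adj_eqI endo_scale) (simp_all add: form_simps adj)

lemma form_funpow_adj: "endo X \<Longrightarrow> \<beta> ((adj X ^^ n) v) w = \<beta> v ((X ^^ n) w)"
  by (induction n arbitrary: w) (simp_all add: adj, simp add: funpow_swap1)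

lemma adj_nilpotent: "endo X \<Longrightarrow> (\<And>v. (X ^^ n) v = 0) \<Longrightarrow> (adj X ^^ n) v = 0"
  by (rule form_eqI) (simp add: form_funpow_adj form_simps)

lemma form_sum_left: "\<beta> (\<Sum>i\<in>I. g i) w = (\<Sum>i\<in>I. \<beta> (g i) w)"
  by (rule module_hom.sum[OF form_hom(2)])

lemma form_sum_right: "\<beta> w (\<Sum>i\<in>I. g i) = (\<Sum>i\<in>I. \<beta> w (g i))"
  by (rule module_hom.sum[OF form_hom(1)])

lemma adj_nexp: "endo X \<Longrightarrow> adj (nexp X) = nexp (adj X)"
  by (intro ext adj_eqI endo_nexp)
    (simp_all add: nilpotent_exp_def form_sum_left form_sum_right form_simps form_funpow_adj)

lemma orth_antimono: "A \<subseteq> B \<Longrightarrow> orth \<beta> B \<subseteq> orth \<beta> A"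
  by (auto simp: orth_def)

lemma subspace_orth: "subspace (orth \<beta> A)"
  by (auto simp: subspace_def orth_def form_simps)

lemma orth_0: "orth \<beta> {0} = UNIV"
  by (simp add: orth_def form_simps)

lemma orth_UNIV: "orth \<beta> UNIV = {0}"
  by (auto simp: orth_def form_simps intro: form_eqI)

text \<open>The adjoint of the projection onto \<open>A\<close> along \<open>B\<close> is again
  idempotent, with kernel \<open>orth \<beta> A\<close> and image \<open>orth \<beta> B\<close>;
  kernel and image of an idempotent are complementary.\<close>

lemma
  assumes "subspace A" "subspace B" "direct_sum_UNIV A B"
  shows direct_sum_orth: "direct_sum_UNIV (orth \<beta> A) (orth \<beta> B)"
    and orth_orth: "orth \<beta> (orth \<beta> A) = A"
proof -
  let ?p = "direct_sum_proj A B"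
  note p = direct_sum_proj_in[OF assms] direct_sum_proj_diff_in[OF assms]
    direct_sum_proj_eqI[OF assms] endo_direct_sum_proj[OF assms]
  have pA: "?p v = v" if "v \<in> A" for v
    using that assms(2) by (intro p(3)) (auto intro: subspace_0)
  have pB: "?p v = 0" if "v \<in> B" for v
    using that assms(1) by (intro p(3)) (auto intro: subspace_0)
  have orth_A: "orth \<beta> A = {v. adj ?p v = 0}"
  proof -
    have "(\<forall>w\<in>A. \<beta> v w = 0) \<longleftrightarrow> (\<forall>w. \<beta> v (?p w) = 0)" for v
      using p(1) pA by metis
    also have "\<dots> v \<longleftrightarrow> adj ?p v = 0" for v
      using adj_eqI[OF p(4), of 0 v] adj[OF p(4), of v] by (auto simp: form_simps)
    finally show ?thesis by (simp add: orth_def)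
  qed
  have orth_B: "orth \<beta> B = {v. adj ?p v = v}"
  proof -
    have "(\<forall>w\<in>B. \<beta> v w = 0) \<longleftrightarrow> (\<forall>w. \<beta> v (w - ?p w) = 0)" for v
      using p(2) pB by (metis diff_zero)
    also have "\<dots> v \<longleftrightarrow> adj ?p v = v" for v
      using adj_eqI[OF p(4), of v v] adj[OF p(4), of v] by (auto simp: form_simps)
    finally show ?thesis by (simp add: orth_def)
  qed
  have idem: "adj ?p (adj ?p v) = adj ?p v" for v
    by (intro adj_eqI p(4)) (simp add: adj[OF p(4)] pA[OF p(1)])
  have diff: "v - adj ?p v \<in> orth \<beta> A" for v
    using module_hom.diff[OF endo_adj[OF p(4)]] by (simp add: orth_A idem)
  show "direct_sum_UNIV (orth \<beta> A) (orth \<beta> B)"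
    unfolding direct_sum_UNIV_def
  proof (intro conjI allI)
    show "orth \<beta> A \<inter> orth \<beta> B = {0}"
      using module_hom.zero[OF endo_adj[OF p(4)]] by (auto simp: orth_A orth_B)
    show "\<exists>a\<in>orth \<beta> A. \<exists>b\<in>orth \<beta> B. v = a + b" for v
      by (rule bexI[OF bexI[OF _, of _ "adj ?p v"] diff[of v]]) (simp_all add: orth_B idem)
  qed
  show "orth \<beta> (orth \<beta> A) = A"
  proof
    show "A \<subseteq> orth \<beta> (orth \<beta> A)"
      by (auto simp: orth_def form_flip_0)
    show "orth \<beta> (orth \<beta> A) \<subseteq> A"
    proof
      fix v assume "v \<in> orth \<beta> (orth \<beta> A)"
      \<comment> \<open>Orthogonality to the range of the complementary projection says that the
        double adjoint of \<open>?p\<close>, which is \<open>?p\<close> itself, fixes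
        \<open>v\<close>.\<close>
      then have "\<beta> v (w - adj ?p w) = 0" for w
        using diff by (auto simp: orth_def)
      then have "adj (adj ?p) v = v"
        by (intro adj_eqI endo_adj p(4)) (simp add: form_simps)
      then have "?p v = v" by (simp add: adj_adj[OF p(4)])
      then show "v \<in> A" using p(1)[of v] by simp
    qed
  qed
qed

text \<open>Moving \<open>exp X\<close> across the form shows that the left side is the preimage of
  \<open>orth \<beta> A\<close> under the exponential of the adjoint, whose inverse is the
  exponential of the negative adjoint.\<close>

lemma orth_nexp_image:
  assumes X: "endo X" "\<And>v. (X ^^ k) v = 0"
  shows "orth \<beta> (nexp X ` A) = nexp (\<lambda>v. - adj X v) ` orth \<beta> A"
proof -
  have "orth \<beta> (nexp X ` A) = {v. nexp (adj X) v \<in> orth \<beta> A}"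
    using adj[OF endo_nexp[OF X(1)]] by (simp add: orth_def adj_nexp[OF X(1)])
  also have "\<dots> = nexp (\<lambda>v. - adj X v) ` orth \<beta> A"
    using nexp_minus_left[OF endo_adj[OF X(1)] adj_nilpotent[OF X]]
      nexp_minus_right[OF endo_adj[OF X(1)] adj_nilpotent[OF X]]
    by (auto simp: image_iff) metis
  finally show ?thesis .
qed

abbreviation perp where "perp \<equiv> flag_orth \<beta> k"

lemma perp_perp:
  assumes "transversal e f"
  shows "perp (perp e) = e"
proof
  fix i
  show "perp (perp e) i = e i"
  proof (cases "i \<le> k")
    case True
    then show ?thesis
      using assms orth_orth[of "e i" "f (k - i)"]
      by (auto simp: flag_orth_def flag_transversal_iff intro: flag_subspace)
  next
    case False
    then show ?thesis
      using transversal_flags(1)[OF assms] by (simp add: flag_orth_def flag_0 flag_top orth_0 orth_UNIV)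
  qed
qed

lemma flag_perp:
  assumes ef: "transversal e f"
  shows "flag scale k (perp e)"
  unfolding flag_def
proof (intro conjI allI impI)
  note e = transversal_flags(1)[OF ef]
  show "perp e 0 = {0}" by (simp add: flag_orth_def flag_top[OF e] orth_UNIV)
  show "perp e i = UNIV" if "k \<le> i" for i
    using that by (simp add: flag_orth_def flag_0[OF e] orth_0)
  show "subspace (perp e i)" for i by (simp add: flag_orth_def subspace_orth)
  show "perp e i \<subset> perp e (Suc i)" if i: "i < k" for i
  proof
    show "perp e i \<subseteq> perp e (Suc i)"
      unfolding flag_orth_def by (intro orth_antimono flag_mono[OF e]) simp
    \<comment> \<open>Strictness uses the double complement: equal levels of \<open>perp e\<close>
      would give equal consecutive levels of \<open>e\<close>.\<close>
    show "perp e i \<noteq> perp e (Suc i)"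
    proof
      assume eq: "perp e i = perp e (Suc i)"
      have orth_perp: "orth \<beta> (perp e j) = e (k - j)" if "j \<le> k" for j
        using fun_cong[OF perp_perp[OF ef], of "k - j"] that by (simp add: flag_orth_def)
      have "e (k - i) = e (k - Suc i)"
        using orth_perp[of i] orth_perp[of "Suc i"] i eq by simp
      moreover have "e (k - Suc i) \<subset> e (Suc (k - Suc i))"
        using e i by (simp add: flag_def)
      ultimately show False using i by (simp add: Suc_diff_Suc)
    qed
  qed
qed

lemma transversal_perp:
  assumes ef: "transversal e f"
  shows "transversal (perp e) (perp f)"
proof -
  have fe: "transversal f e" using ef flag_transversal_commute by blast
  have "direct_sum_UNIV (perp e i) (perp f (k - i))" if "i \<le> k" for i
  proof -
    have "direct_sum_UNIV (e (k - i)) (f (k - (k - i)))"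
      using ef by (simp add: flag_transversal_iff)
    then show ?thesis
      unfolding flag_orth_def
      by (intro direct_sum_orth flag_subspace[OF transversal_flags(1)[OF ef]]
          flag_subspace[OF transversal_flags(2)[OF ef]])
  qed
  then show ?thesis
    using flag_perp[OF ef] flag_perp[OF fe] by (simp add: flag_transversal_iff)
qed

lemma perp_chart: "flag scale k f \<Longrightarrow> X \<in> nilrad f \<Longrightarrow> perp (chart e X) = chart (perp e) (\<lambda>v. - adj X v)"
  by (intro ext)
    (simp add: flag_orth_def flag_chart_def flag_act_def orth_nexp_image nilrad_endo nilrad_nilpotent)

text \<open>Orthogonality reverses the filtration: \<open>X\<close> maps
  \<open>f (k - (i - 1))\<close> into \<open>f (k - i)\<close>, so its adjoint maps
  \<open>orth \<beta> (f (k - i))\<close> into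
  \<open>orth \<beta> (f (k - (i - 1)))\<close>.\<close>

lemma adj_nilrad:
  assumes ef: "transversal e f" and X: "X \<in> nilrad f"
  shows "(\<lambda>v. - adj X v) \<in> nilrad (perp f)"
proof (rule nilrad_uminus)
  note fl = transversal_flags[OF ef]
  show f': "flag scale k (perp f)"
    using transversal_flags(2)[OF transversal_perp[OF ef]] .
  have X1: "X \<in> flag_lower scale k f 1"
    using X by (simp add: flag_nilradical_eq_lower[OF fl(2)])
  note eX = nilrad_endo[OF X]
  have "adj X v \<in> perp f (i - 1)" if "i \<le> k" "v \<in> perp f i" for i v
  proof (cases "i = 0")
    case True
    then show ?thesis
      using that flag_0[OF f'] module_hom.zero[OF endo_adj[OF eX]] by simp
  next
    case False
    have "\<beta> v (X w) = 0" if w: "w \<in> f (k - (i - 1))" for w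
    proof -
      have "X w \<in> f (k - i)"
        using flag_lowerD[OF X1 _ w] \<open>i \<le> k\<close> False by simp
      then show ?thesis using \<open>v \<in> perp f i\<close> by (simp add: flag_orth_def orth_def)
    qed
    then show ?thesis by (simp add: flag_orth_def orth_def adj[OF eX])
  qed
  then show "adj X \<in> nilrad (perp f)"
    by (simp add: flag_nilradical_eq_lower[OF f'] flag_lower_def endo_adj[OF eX])
qed

lemma flag_log_perp:
  assumes ef: "transversal e f" and af: "transversal a f"
  shows "flag_log scale k (perp e) (perp f) (perp a) = (\<lambda>v. - adj (flag_log scale k e f a) v)"
proof -
  note L = flag_log[OF ef af]
  have "perp a = chart (perp e) (\<lambda>v. - adj (flag_log scale k e f a) v)"
    using perp_chart[OF transversal_flags(2)[OF ef] L(1), of e] L(2) by simp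
  then show ?thesis
    using flag_log_chart[OF transversal_perp[OF ef] adj_nilrad[OF ef L(1)]] by simp
qed

lemma perp_linear:
  assumes ef: "transversal e f"
  shows "linear_map_on {a. transversal a f} (flag_add scale k e f) (flag_smul scale k e f)
    {a. transversal a (perp f)} (flag_add scale k (perp e) (perp f)) (flag_smul scale k (perp e) (perp f))
    perp"
  unfolding linear_map_on_def
proof (intro conjI ballI allI)
  note f = transversal_flags(2)[OF ef]
  show "perp ` {a. transversal a f} \<subseteq> {a. transversal a (perp f)}"
    using transversal_perp by auto
  fix a assume "a \<in> {a. transversal a f}"
  then have a: "transversal a f" by simp
  note L = flag_log(1)[OF ef a]
  show "perp (flag_smul scale k e f r a) = flag_smul scale k (perp e) (perp f) r (perp a)" for r
  proof -
    have "(\<lambda>v. scale r (flag_log scale k e f a v)) \<in> nilrad f"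
      using L by (simp add: flag_nilradical_eq_lower[OF f] flag_lower_scale[OF f])
    from perp_chart[OF f this] show ?thesis
      by (simp add: flag_smul_def flag_log_perp[OF ef a] adj_scale nilrad_endo[OF L])
  qed
  fix b assume "b \<in> {a. transversal a f}"
  then have b: "transversal b f" by simp
  note M = flag_log(1)[OF ef b]
  have "(\<lambda>v. flag_log scale k e f a v + flag_log scale k e f b v) \<in> nilrad f"
    using L M by (simp add: flag_nilradical_eq_lower[OF f] flag_lower_add[OF f])
  from perp_chart[OF f this]
  show "perp (flag_add scale k e f a b) = flag_add scale k (perp e) (perp f) (perp a) (perp b)"
    by (simp add: flag_add_def flag_log_perp[OF ef a] flag_log_perp[OF ef b] adj_add
        nilrad_endo[OF L] nilrad_endo[OF M] algebra_simps)
qed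

lemma complemented_flagE:
  assumes "e \<in> complemented_flags scale k"
  obtains f where "transversal e f"
  using assms by (auto simp: complemented_flags_def)

lemma perp_hom: "geometry_hom geometry geometry perp perp"
  unfolding geometry_hom_def geometry_simps
proof (intro conjI allI impI linear_pair_geometry_flags transversal_perp)
  show *: "perp ` complemented_flags scale k \<subseteq> complemented_flags scale k"
    by (auto elim!: complemented_flagE intro: flag_transversal_complemented1 transversal_perp)
  show "perp ` complemented_flags scale k \<subseteq> complemented_flags scale k" by (rule *)
qed (auto intro: perp_linear flag_transversal_commute[THEN iffD1])

text \<open>On complemented flags \<open>perp\<close> is an involution, so it serves as its own
  inverse homomorphism.\<close>

lemma perp_automorphism: "geometry_automorphism geometry perp perp"
  unfolding geometry_automorphism_def
  using perp_hom perp_perp by (auto simp: geometry_simps elim!: complemented_flagE)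

section \<open>Lagrangian flags as fixed points\<close>

abbreviation lagrangians where "lagrangians \<equiv> complemented_lagrangian_flags scale \<beta> k"

lemma lagrangian_flag_iff: "lagrangian_flag scale \<beta> k e \<longleftrightarrow> flag scale k e \<and> perp e = e"
proof -
  have "perp e i = e i" if e: "flag scale k e" and lagr: "\<And>j. j \<in> {1..k} \<Longrightarrow> orth \<beta> (e j) = e (k - j)" for i
  proof (cases "i < k")
    case True
    then show ?thesis using lagr[of "k - i"] by (simp add: flag_orth_def)
  next
    case False
    then show ?thesis by (simp add: flag_orth_def flag_0[OF e] flag_top[OF e] orth_0)
  qed
  moreover have "orth \<beta> (e j) = e (k - j)" if "perp e = e" "j \<le> k" for j
    using fun_cong[OF that(1), of "k - j"] that(2) by (simp add: flag_orth_def)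
  ultimately show ?thesis
    unfolding lagrangian_flag_def by (auto simp del: One_nat_def)
qed

text \<open>If \<open>f\<close> is transversal to a Lagrangian flag \<open>e\<close>, then \<open>perp f = exp(X) f\<close> with \<open>X\<close>
  self-adjoint, and the midpoint \<open>exp(X/2) f\<close> is a Lagrangian flag transversal to \<open>e\<close>.\<close>

lemma perp_fixed_lagrangian_complement:
  assumes ef: "transversal e f" and e: "perp e = e"
  obtains h where "transversal e h" "perp h = h"
proof -
  have fe: "transversal f e" using ef flag_transversal_commute by blast
  have f'e: "transversal (perp f) e" using transversal_perp[OF fe] e by simp
  note eF = transversal_flags(1)[OF ef]
  obtain X where X: "X \<in> nilrad e" "chart f X = perp f"
    by (rule chart_surj[OF fe f'e])
  note eX = nilrad_endo[OF X(1)] and nX = nilrad_nilpotent[OF eF X(1)]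
  have adjX: "adj X \<in> nilrad e"
    using nilrad_uminus[OF eF] adj_nilrad[OF fe X(1)] e by force
  note eA = nilrad_endo[OF adjX] and nA = nilrad_nilpotent[OF eF adjX]
  have chart_chart: "chart (chart f (\<lambda>v. scale r (Y v))) (\<lambda>v. scale s (Y v)) = chart f (\<lambda>v. scale (s + r) (Y v))"
    if "Y \<in> nilrad e" for r s Y
    using nexp_scale_add[OF nilrad_endo[OF that] nilrad_nilpotent[OF eF that]]
    by (simp add: flag_chart_def flag_act_def image_image)
  \<comment> \<open>Applying \<open>perp\<close> to \<open>exp(X) f = perp f\<close> and solving for
    \<open>perp f\<close> gives a second representation, by \<open>adj X\<close>; injectivity of the
    chart then yields self-adjointness.\<close>
  have "f = chart (perp f) (\<lambda>v. - adj X v)"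
    using perp_chart[OF eF X(1), of f] X(2) perp_perp[OF fe] by simp
  then have "chart f (adj X) = flag_act (nexp (adj X) \<circ> nexp (\<lambda>v. - adj X v)) (perp f)"
    by (simp add: flag_chart_def flag_act_def image_comp fun_eq_iff)
  also have "nexp (adj X) \<circ> nexp (\<lambda>v. - adj X v) = id"
    using nexp_minus_right[OF eA nA] by auto
  finally have "chart f (adj X) = chart f X"
    by (simp add: X(2) flag_act_def)
  then have selfadj: "adj X = X"
    using chart_inj[OF fe adjX X(1)] by blast
  define c where "c = unit_inverse (2 :: 'k)"
  have "(c + c) = 2 * c" by simp
  also have "2 * c = 1" unfolding c_def by (rule unit_inverse_right[OF two_unit])
  finally have c: "- c + 1 = c" by (simp add: algebra_simps)
  define h where "h = chart f (\<lambda>v. scale c (X v))"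
  have cX: "(\<lambda>v. scale c (X v)) \<in> nilrad e"
    using X(1) by (simp add: flag_nilradical_eq_lower[OF eF] flag_lower_scale[OF eF])
  \<comment> \<open>With \<open>c = 1/2\<close>, \<open>perp h\<close> is
    \<open>exp(-X/2) exp(X) f = exp(X/2) f\<close>, that is, \<open>h\<close>.\<close>
  have "perp h = chart (perp f) (\<lambda>v. scale (- c) (X v))"
    using perp_chart[OF eF cX, of f] by (simp add: h_def adj_scale[OF eX] selfadj)
  also have "\<dots> = chart (chart f (\<lambda>v. scale 1 (X v))) (\<lambda>v. scale (- c) (X v))"
    by (simp add: X(2))
  also have "\<dots> = h"
    unfolding chart_chart[OF X(1)] c h_def ..
  finally have "perp h = h" .
  moreover have "transversal e h"
    using chart_transversal[OF fe cX] flag_transversal_commute by (simp add: h_def)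
  ultimately show thesis by (rule that[rotated])
qed

text \<open>The substance is that a fixed flag with some transversal flag also has a Lagrangian
  one.\<close>

lemma lagrangians_eq: "lagrangians = {e \<in> complemented_flags scale k. perp e = e}"
proof -
  have "e \<in> lagrangians" if ef: "transversal e f" "perp e = e" for e f
  proof -
    obtain h where "transversal e h" "perp h = h"
      by (rule perp_fixed_lagrangian_complement[OF ef])
    then show ?thesis
      using ef(2) transversal_flags unfolding complemented_lagrangian_flags_def lagrangian_flag_iff
      by blast
  qed
  then show ?thesis
    by (auto simp: complemented_lagrangian_flags_def lagrangian_flag_iff
        elim!: complemented_flagE intro: flag_transversal_complemented1)
qed

lemma lagrangians_transversal:
  assumes "e \<in> lagrangians"
  obtains f where "f \<in> lagrangians" "transversal e f"
  using assms flag_transversal_commute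
  unfolding complemented_lagrangian_flags_def by blast

text \<open>Since \<open>e\<close> and \<open>f\<close> are fixed, \<open>perp\<close> is a linear
  self-map of the module at this pair, and the set in question consists of its fixed
  vectors.\<close>

lemma lagrangians_linear_subspace:
  assumes ef: "transversal e f" and e: "perp e = e" and f: "perp f = f"
  shows "linear_subspace_on (lagrangians \<inter> {a. transversal a f}) {a. transversal a f} e
    (flag_add scale k e f) (flag_smul scale k e f)"
proof -
  have eq: "lagrangians \<inter> {a. transversal a f} = {a. transversal a f \<and> perp a = a}"
    by (auto simp: lagrangians_eq flag_transversal_complemented1)
  have sub: "{a \<in> complemented_flags scale k. transversal a f} = {a. transversal a f}"
    using flag_transversal_complemented1 by auto
  note lin = perp_linear[OF ef, unfolded e f linear_map_on_def]
  note mod = module_on_transversal[OF ef, unfolded sub module_on_def]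
  show ?thesis
    unfolding eq linear_subspace_on_def using ef e lin mod by (simp, blast)
qed

lemma lagrangians_subspace: "geometry_subspace geometry lagrangians lagrangians"
  unfolding geometry_subspace_def geometry_simps
proof (intro conjI ballI impI linear_pair_geometry_flags)
  fix x \<alpha> assume *: "x \<in> lagrangians" "\<alpha> \<in> lagrangians" "transversal x \<alpha>"
  then have p: "perp x = x" "perp \<alpha> = \<alpha>" by (simp_all add: lagrangians_eq)
  have "transversal \<alpha> x" using * flag_transversal_commute by blast
  from lagrangians_linear_subspace[OF *(3) p] lagrangians_linear_subspace[OF this p(2,1)] show
    "linear_subspace_on (lagrangians \<inter> {a. transversal a \<alpha>}) {a. transversal a \<alpha>} x
       (flag_add scale k x \<alpha>) (flag_smul scale k x \<alpha>)"
    "linear_subspace_on (lagrangians \<inter> {a. transversal a x}) {a. transversal a x} \<alpha>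
       (flag_add scale k \<alpha> x) (flag_smul scale k \<alpha> x)" .
next
  fix x assume "x \<in> lagrangians"
  then obtain \<alpha> where "\<alpha> \<in> lagrangians" "transversal x \<alpha>" by (rule lagrangians_transversal)
  then show "\<exists>\<alpha>\<in>lagrangians. transversal x \<alpha>" "\<exists>\<alpha>\<in>lagrangians. transversal \<alpha> x"
    using flag_transversal_commute by blast+
qed (auto simp: lagrangians_eq)

end

section \<open>Independence of the base point for \<open>k = 2\<close>\<close>

context exponential_module
begin

lemma affine_op_flags:
  assumes ef: "transversal e f" and a: "transversal a f" and b: "transversal b f" and c: "transversal c f"
  shows "affine_op (flag_add scale k e f) (flag_smul scale k e f) r a b c =
    chart e (\<lambda>v. flag_log scale k e f a v + scale r (flag_log scale k e f b v - flag_log scale k e f c v))"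
proof -
  note f = transversal_flags(2)[OF ef]
  have L: "flag_log scale k e f x \<in> flag_lower scale k f 1" if "transversal x f" for x
    using flag_log(1)[OF ef that] by (simp add: flag_nilradical_eq_lower[OF f])
  have log: "flag_log scale k e f (chart e X) = X" if "X \<in> flag_lower scale k f 1" for X
    using flag_log_chart[OF ef] that by (simp add: flag_nilradical_eq_lower[OF f])
  show ?thesis
    by (simp add: affine_op_def flag_add_def flag_smul_def L a b c log flag_lower_add[OF f]
        flag_lower_uminus[OF f] flag_lower_diff[OF f] flag_lower_scale[OF f] del: One_nat_def)
qed

text \<open>For \<open>k = 2\<close> the nilradical has zero products, so \<open>exp X = 1 + X\<close> and a change of origin is a
  translation.\<close>

lemma affine_op_flags_2:
  assumes k: "k = 2" and xf: "transversal x f" and yf: "transversal y f"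
    and a: "transversal a f" and b: "transversal b f" and c: "transversal c f"
  shows "affine_op (flag_add scale k x f) (flag_smul scale k x f) r a b c =
    affine_op (flag_add scale k y f) (flag_smul scale k y f) r a b c"
proof -
  note f = transversal_flags(2)[OF xf]
  have nexp2: "nexp X v = v + X v" for X v
    by (simp add: nilpotent_exp_def k numeral_2_eq_2 unit_inverse_1)
  have prod0: "X (Y v) = 0" if "X \<in> nilrad f" "Y \<in> nilrad f" for X Y v
    using flag_lower_ge[OF f _ flag_lower_comp[OF that[unfolded flag_nilradical_eq_lower[OF f]]]]
    by (simp add: k)
  define A where "A z = flag_log scale k x f z" for z
  have A: "A z \<in> nilrad f" "chart x (A z) = z" if "transversal z f" for z
    using flag_log[OF xf that] by (simp_all add: A_def)
  \<comment> \<open>Since \<open>y = exp(A y) x\<close> and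
    \<open>(1 + X)(1 + A y) = 1 + X + A y\<close>, passing from origin \<open>y\<close> to origin
    \<open>x\<close> adds \<open>A y\<close>.\<close>
  have shift: "chart y X = chart x (\<lambda>v. X v + A y v)" if "X \<in> nilrad f" for X
  proof -
    have "chart y X = chart (chart x (A y)) X" using A(2)[OF yf] by simp
    also have "\<dots> = chart x (\<lambda>v. X v + A y v)"
      using prod0[OF that A(1)[OF yf]] module_hom.add[OF nilrad_endo[OF that]]
      by (simp add: flag_chart_def flag_act_def image_image nexp2 ac_simps)
    finally show ?thesis .
  qed
  have log: "flag_log scale k y f z = (\<lambda>v. A z v - A y v)" if z: "transversal z f" for z
  proof -
    have n: "(\<lambda>v. A z v - A y v) \<in> nilrad f"
      using A(1)[OF z] A(1)[OF yf] by (simp add: flag_nilradical_eq_lower[OF f] flag_lower_diff[OF f])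
    have "chart y (\<lambda>v. A z v - A y v) = z"
      using shift[OF n] A(2)[OF z] by simp
    then show ?thesis using flag_log_chart[OF yf n] by simp
  qed
  \<comment> \<open>In logarithms at \<open>y\<close> the term \<open>A y\<close> cancels from the
    difference of \<open>b\<close> and \<open>c\<close>; the one left from \<open>a\<close> is
    undone by \<open>shift\<close>.\<close>
  have n: "(\<lambda>v. (A a v - A y v) + scale r (A b v - A c v)) \<in> nilrad f"
    using A(1)[OF a] A(1)[OF b] A(1)[OF c] A(1)[OF yf]
    by (simp add: flag_nilradical_eq_lower[OF f] flag_lower_add[OF f] flag_lower_diff[OF f] flag_lower_scale[OF f])
  show ?thesis
    using shift[OF n]
    by (simp add: affine_op_flags[OF xf a b c] affine_op_flags[OF yf a b c] log a b c
        algebra_simps flip: A_def)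
qed

end

text \<open>The Lagrangian geometry keeps the operations of the flag geometry, so the equality of
  affine operations there restricts to it.\<close>

lemma (in form_module) lagrangian_geometry_affine:
  assumes k: "k = 2"
  shows "affine_pair_geometry (lagrangian_geometry scale \<beta> k)"
proof -
  let ?G = "lagrangian_geometry scale \<beta> k"
  have simps: "copoints ?G = lagrangians" "points ?G = lagrangians"
    "add_pt ?G e f = flag_add scale k e f" "smul_pt ?G e f = flag_smul scale k e f"
    "add_co ?G e f = flag_add scale k f e" "smul_co ?G e f = flag_smul scale k f e" for e f
    by (simp_all add: lagrangian_geometry_def restrict_geometry_def flag_geometry_def)
  have v: "y \<in> v_pt ?G \<alpha> \<Longrightarrow> transversal y \<alpha>" "\<alpha> \<in> v_co ?G y \<Longrightarrow> transversal \<alpha> y" for y \<alpha>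
    using flag_transversal_commute
    by (auto simp: v_pt_def v_co_def lagrangian_geometry_def restrict_geometry_def flag_geometry_def)
  show ?thesis
    unfolding affine_pair_geometry_def same_affine_structure_def simps
    using linear_pair_geometry_restrict[OF lagrangians_subspace]
    by (auto simp flip: lagrangian_geometry_def intro!: affine_op_flags_2[OF k] dest!: v)
qed

theorem theorem4p2:
  fixes scale :: "'k::comm_ring_1 \<Rightarrow> 'm::ab_group_add \<Rightarrow> 'm"
    and \<beta> :: "'m \<Rightarrow> 'm \<Rightarrow> 'k"
    and k :: nat
  assumes "module scale"
    and "(2 :: 'k) dvd 1"
    and "bilinear_form scale \<beta>"
    and "strongly_nondegenerate scale \<beta>"
    and "symmetric_form \<beta> \<or> skew_symmetric_form \<beta>"
    and "k \<ge> 2"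
    and "\<forall>i. 2 \<le> i \<and> i \<le> k - 1 \<longrightarrow> (of_nat i :: 'k) dvd 1"
  shows "geometry_automorphism (flag_geometry scale k) (flag_orth \<beta> k) (flag_orth \<beta> k) \<and>
    fixed_points (flag_geometry scale k) (flag_orth \<beta> k) (flag_orth \<beta> k)
      = (complemented_lagrangian_flags scale \<beta> k, complemented_lagrangian_flags scale \<beta> k) \<and>
    geometry_subspace (flag_geometry scale k)
      (complemented_lagrangian_flags scale \<beta> k) (complemented_lagrangian_flags scale \<beta> k) \<and>
    linear_pair_geometry (lagrangian_geometry scale \<beta> k) \<and>
    (k = 2 \<longrightarrow> affine_pair_geometry (lagrangian_geometry scale \<beta> k))"
proof -
  have "\<forall>i. 2 \<le> i \<and> i < k \<longrightarrow> (of_nat i :: 'k) dvd 1"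
    using assms(7) by (metis Suc_pred' less_Suc_eq_le order_le_less_trans zero_le)
  then have "(of_nat (fact n) :: 'k) dvd 1" if "n < k" for n
    using that by (rule of_nat_fact_dvd_1)
  then interpret form_module scale k \<beta>
    using assms
    by (simp add: form_module_def form_module_axioms_def exponential_module_def
        exponential_module_axioms_def endomorphism_module_def)
  show ?thesis
    using perp_automorphism lagrangians_subspace lagrangian_geometry_affine
      linear_pair_geometry_restrict[OF lagrangians_subspace]
    by (auto simp: fixed_points_def geometry_simps lagrangians_eq lagrangian_geometry_def)
qed

end
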